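(* (i) Let $\mathbb{A}$ be an algebraic associative real algebra with no nontrivial joint zero-divisors. Then $\mathbb{A}$ is locally complex and, equipped with its natural norm, is isometrically isomorphic to $\mathbb{R}$, $\mathbb{C}$, or $\mathbb{H}$. (ii) Let $\mathbb{A}$ be an associative real algebra. Then $\mathbb{A}$ is locally complex and, equipped with its natural norm, is isometrically isomorphic to $\mathbb{R}$, $\mathbb{C}$, or $\mathbb{H}$ if one of the following conditions holds: (a) $\mathbb{A}$ is endowed with a vector space norm relative to which its multiplication is separately continuous, and $\mathbb{A}$ has no nontrivial joint topological zero-divisors; (b) $\mathbb{A}$ is a quasi-division real algebra endowed with a vector space norm relative to which its multiplication is separately continuous; (c) $\mathbb{A}$ is endowed with a $c$-supermultiplicative vector space norm for some $c>0$ relative to which the multiplication is separately continuous (e.g., a real nearly absolute value); (d) $\mathbb{A}$ is a topological quasi-division real algebra, equivalently, a (topological) classical division algebra, whose topological dual separates its points. (iii) Let $\mathbb{A}$ be an associative real algebra. Then $\mathbb{A}$ is isometrically isomorphic to $\mathbb{R}$, $\mathbb{C}$, or $\mathbb{H}$ if one of the following conditions holds, in which case the given norm of $\mathbb{A}$ coincides with its natural norm that comes from its locally complex structure: (a) $\mathbb{A}$ is a real $C^*$-algebra with no nontrivial joint topological zero-divisors or a quasi-division real $C^*$-algebra; (b) $\mathbb{A}$ is a quasi-division real algebra equipped with a vector space norm $\|\cdot\|$ relative to which its multiplication is separately continuous and satisfying the identity $\|x^k\|=\|x\|^k$ on $\mathbb{A}$ for a fixed positive integer $k>1$; (c) $\mathbb{A}$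 is a real algebra equipped with a vector space norm $\|\cdot\|$ relative to which its multiplication is separately continuous and satisfying the identity $\|x^k\|=\|x\|^k$ on $\mathbb{A}$ for a fixed positive integer $k>1$, and with no nontrivial joint topological zero-divisors; (d) $\mathbb{A}$ is an absolute-valued real algebra.
   Context: Algebras are nonzero and not necessarily unital. $L_ax=ax$, $R_ax=xa$. An algebra is algebraic if every subalgebra generated by one element is finite-dimensional. An element $a$ is a joint zero-divisor if $ab=ba=0$ for some $b\neq0$; zero is the trivial one. A unital algebra is quadratic if the unital subalgebra generated by any element is at most two-dimensional. A real quadratic algebra is locally complex if the unital subalgebra generated by any element is a field extension of $\mathbb{R}$. The natural norm of a locally complex algebra is the unique vector space norm on it that comes from an inner product and satisfies $\|x^k\|=\|x\|^k$ for all $x$ and all $k\in\mathbb{N}$. An algebra is quasi-division if for every $a\neq 0$ at least one of $L_a,R_a$ is bijective; a classical division algebra if it is unital and every nonzero element is invertible. A topological real algebra has a Hausdorff topology such that addition and scalar multiplication are continuous, multiplication is separately continuous, and inversion is continuous on the set of invertible elements; its topological dual is the space of continuous linear functionals. A norm is $c$-supermultiplicative if $c\|a\|\|b\|\le\|ab\|$ for all $a,b$; a nearly absolute value is a submultiplicative norm that is $c$-supermultiplicative for some $c>0$; an absolute value is a norm with $\|ab\|=\|a\|\|b\|$, and an absolute-valued algebra is an algebra with an absolute value. An element $a$ is a joint topological zero-divisor if there are $b_n$ with $\|b_n\|=1$ and $\lim_n ab_n=\lim_n b_na=0$; zero is the trivial one. A $C^*$-algebra is a complex Banach algebra with an involution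 $*$ satisfying $\|a^*a\|=\|a\|^2$; a real $C^*$-algebra is a closed real $*$-subalgebra of a $C^*$-algebra. $\mathbb{R}$, $\mathbb{C}$, $\mathbb{H}$ (real quaternions) carry the Euclidean norm; "isomorphic" means as real algebras. *)

theory Defs
  imports "HOL-Analysis.Analysis"
begin

text \<open>
  Algebras are types of class \<^class>\<open>real_algebra\<close>: associative real algebras, not necessarily
  unital. Nontriviality is not part of the class. Norms and topologies are explicit
  functions and \<^typ>\<open>'a topology\<close> objects, since one algebra carries several of them.
\<close>

datatype quat = Quat (Re4: real) (Im4: real) (Jm4: real) (Km4: real)

lemma quat_eq_iff:
  "x = y \<longleftrightarrow> Re4 x = Re4 y \<and> Im4 x = Im4 y \<and> Jm4 x = Jm4 y \<and> Km4 x = Km4 y"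
  by (cases x; cases y) simp

instantiation quat :: real_algebra_1
begin

definition "0 = Quat 0 0 0 0"
definition "1 = Quat 1 0 0 0"
definition "x + y = Quat (Re4 x + Re4 y) (Im4 x + Im4 y) (Jm4 x + Jm4 y) (Km4 x + Km4 y)"
definition "x - y = Quat (Re4 x - Re4 y) (Im4 x - Im4 y) (Jm4 x - Jm4 y) (Km4 x - Km4 y)"
definition "- x = Quat (- Re4 x) (- Im4 x) (- Jm4 x) (- Km4 x)"
definition "r *\<^sub>R x = Quat (r * Re4 x) (r * Im4 x) (r * Jm4 x) (r * Km4 x)"
definition "x * y = Quat
  (Re4 x * Re4 y - Im4 x * Im4 y - Jm4 x * Jm4 y - Km4 x * Km4 y)
  (Re4 x * Im4 y + Im4 x * Re4 y + Jm4 x * Km4 y - Km4 x * Jm4 y)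
  (Re4 x * Jm4 y - Im4 x * Km4 y + Jm4 x * Re4 y + Km4 x * Im4 y)
  (Re4 x * Km4 y + Im4 x * Jm4 y - Jm4 x * Im4 y + Km4 x * Re4 y)"

lemmas quat_ops = zero_quat_def one_quat_def plus_quat_def minus_quat_def uminus_quat_def
  scaleR_quat_def times_quat_def

instance
  by standard (simp_all add: quat_ops quat_eq_iff algebra_simps)

end

instantiation quat :: real_inner
begin

definition "x \<bullet> y = Re4 x * Re4 y + Im4 x * Im4 y + Jm4 x * Jm4 y + Km4 x * Km4 y"
definition "norm (x::quat) = sqrt (x \<bullet> x)"
definition "dist x y = norm (x - y :: quat)"
definition "sgn x = x /\<^sub>R norm (x::quat)"
definition "(uniformity :: (quat \<times> quat) filter) = (INF e\<in>{0<..}. principal {(x, y). dist x y < e})"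
definition "open (U :: quat set) \<longleftrightarrow> (\<forall>x\<in>U. eventually (\<lambda>(x', y). x' = x \<longrightarrow> y \<in> U) uniformity)"

instance
proof
  fix x y z :: quat and r :: real
  show "dist x y = norm (x - y)" by (rule dist_quat_def)
  show "sgn x = x /\<^sub>R norm x" by (rule sgn_quat_def)
  show "(uniformity :: (quat \<times> quat) filter) = (INF e\<in>{0<..}. principal {(x, y). dist x y < e})"
    by (rule uniformity_quat_def)
  show "open U \<longleftrightarrow> (\<forall>x\<in>U. eventually (\<lambda>(x', y). x' = x \<longrightarrow> y \<in> U) uniformity)" for U :: "quat set"
    by (rule open_quat_def)
  show "x \<bullet> y = y \<bullet> x" by (simp add: inner_quat_def mult.commute)
  show "(x + y) \<bullet> z = x \<bullet> z + y \<bullet> z" by (simp add: inner_quat_def quat_ops algebra_simps)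
  show "(r *\<^sub>R x) \<bullet> y = r * (x \<bullet> y)" by (simp add: inner_quat_def quat_ops algebra_simps)
  show "0 \<le> x \<bullet> x" by (simp add: inner_quat_def)
  have "a * a + b * b + c * c + d * d = 0 \<longleftrightarrow> a = 0 \<and> b = 0 \<and> c = 0 \<and> d = 0" for a b c d :: real
    by (smt (verit) mult_eq_0_iff zero_le_square)
  then show "x \<bullet> x = 0 \<longleftrightarrow> x = 0" by (simp add: inner_quat_def quat_ops quat_eq_iff)
  show "norm x = sqrt (x \<bullet> x)" by (rule norm_quat_def)
qed

end

text \<open>In the absence of a unit only powers with exponent \<open>k \<ge> 1\<close> make sense;
  \<open>apow x 0 = x\<close> is a junk value.\<close>

definition apow :: "'a::real_algebra \<Rightarrow> nat \<Rightarrow> 'a" where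
  "apow x k = (((*) x) ^^ (k - 1)) x"

definition real_subalgebra :: "'a::real_algebra set \<Rightarrow> bool" where
  "real_subalgebra S \<longleftrightarrow> subspace S \<and> (\<forall>x\<in>S. \<forall>y\<in>S. x * y \<in> S)"

definition fin_dim :: "'a::real_vector set \<Rightarrow> bool" where
  "fin_dim S \<longleftrightarrow> (\<exists>B. finite B \<and> span B = S)"

definition algebraic_algebra :: "'a::real_algebra itself \<Rightarrow> bool" where
  "algebraic_algebra _ \<longleftrightarrow> (\<forall>a::'a. fin_dim (real_subalgebra hull {a}))"

definition joint_zero_divisor :: "'a::real_algebra \<Rightarrow> bool" where
  "joint_zero_divisor a \<longleftrightarrow> (\<exists>b. b \<noteq> 0 \<and> a * b = 0 \<and> b * a = 0)"

definition is_unit_element :: "'a::real_algebra \<Rightarrow> bool" where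
  "is_unit_element e \<longleftrightarrow> (\<forall>x. e * x = x \<and> x * e = x)"

definition unital_algebra :: "'a::real_algebra itself \<Rightarrow> bool" where
  "unital_algebra _ \<longleftrightarrow> (\<exists>e::'a. is_unit_element e)"

definition is_inverse :: "'a::real_algebra \<Rightarrow> 'a \<Rightarrow> bool" where
  "is_inverse x y \<longleftrightarrow> is_unit_element (x * y) \<and> is_unit_element (y * x)"

definition invertible_element :: "'a::real_algebra \<Rightarrow> bool" where
  "invertible_element x \<longleftrightarrow> (\<exists>y. is_inverse x y)"

definition alg_inverse :: "'a::real_algebra \<Rightarrow> 'a" where
  "alg_inverse x = (THE y. is_inverse x y)"

text \<open>The unital subalgebra generated by \<open>a\<close> is \<open>real_subalgebra hull {e, a}\<close> with \<open>e\<close> the unit.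
  Finite-dimensionality is required explicitly because \<^const>\<open>dim\<close> is \<open>0\<close> on
  infinite-dimensional spaces.\<close>

definition quadratic_algebra :: "'a::real_algebra itself \<Rightarrow> bool" where
  "quadratic_algebra _ \<longleftrightarrow> unital_algebra TYPE('a) \<and>
     (\<forall>e::'a. is_unit_element e \<longrightarrow> (\<forall>a. fin_dim (real_subalgebra hull {e, a}) \<and>
        dim (real_subalgebra hull {e, a}) \<le> 2))"

text \<open>A unital subalgebra \<open>K\<close> of a real algebra (with unit \<open>e\<close>) contains \<open>\<real>e\<close>; so it is a field extension
  of \<open>\<real>\<close> iff it is a field.\<close>

definition is_field_extension :: "'a::real_algebra \<Rightarrow> 'a set \<Rightarrow> bool" where
  "is_field_extension e K \<longleftrightarrow> real_subalgebra K \<and> e \<in> K \<and> e \<noteq> 0 \<and>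
     (\<forall>x\<in>K. e * x = x) \<and> (\<forall>x\<in>K. \<forall>y\<in>K. x * y = y * x) \<and>
     (\<forall>x\<in>K. x \<noteq> 0 \<longrightarrow> (\<exists>y\<in>K. x * y = e))"

definition locally_complex :: "'a::real_algebra itself \<Rightarrow> bool" where
  "locally_complex _ \<longleftrightarrow> quadratic_algebra TYPE('a) \<and>
     (\<forall>e::'a. is_unit_element e \<longrightarrow> (\<forall>a. is_field_extension e (real_subalgebra hull {e, a})))"

definition quasi_division :: "'a::real_algebra itself \<Rightarrow> bool" where
  "quasi_division _ \<longleftrightarrow> (\<forall>a::'a. a \<noteq> 0 \<longrightarrow> bij (\<lambda>x. a * x) \<or> bij (\<lambda>x. x * a))"

definition classical_division :: "'a::real_algebra itself \<Rightarrow> bool" where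
  "classical_division _ \<longleftrightarrow> unital_algebra TYPE('a) \<and> (\<forall>a::'a. a \<noteq> 0 \<longrightarrow> invertible_element a)"

definition vs_norm :: "('a::real_vector \<Rightarrow> real) \<Rightarrow> bool" where
  "vs_norm N \<longleftrightarrow> (\<forall>x. 0 \<le> N x) \<and> (\<forall>x. N x = 0 \<longleftrightarrow> x = 0) \<and>
     (\<forall>x y. N (x + y) \<le> N x + N y) \<and> (\<forall>r x. N (r *\<^sub>R x) = \<bar>r\<bar> * N x)"

definition norm_topology :: "('a::real_vector \<Rightarrow> real) \<Rightarrow> 'a topology" where
  "norm_topology N = Metric_space.mtopology UNIV (\<lambda>x y. N (x - y))"

definition separately_continuous_mult :: "'a::real_algebra topology \<Rightarrow> bool" where
  "separately_continuous_mult T \<longleftrightarrow>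
     (\<forall>a. continuous_map T T (\<lambda>x. a * x) \<and> continuous_map T T (\<lambda>x. x * a))"

definition joint_topological_zero_divisor :: "('a::real_algebra \<Rightarrow> real) \<Rightarrow> 'a \<Rightarrow> bool" where
  "joint_topological_zero_divisor N a \<longleftrightarrow> (\<exists>b::nat \<Rightarrow> 'a. (\<forall>n. N (b n) = 1) \<and>
     (\<lambda>n. N (a * b n)) \<longlonglongrightarrow> 0 \<and> (\<lambda>n. N (b n * a)) \<longlonglongrightarrow> 0)"

definition supermultiplicative :: "real \<Rightarrow> ('a::real_algebra \<Rightarrow> real) \<Rightarrow> bool" where
  "supermultiplicative c N \<longleftrightarrow> (\<forall>a b. c * N a * N b \<le> N (a * b))"

definition submultiplicative :: "('a::real_algebra \<Rightarrow> real) \<Rightarrow> bool" where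
  "submultiplicative N \<longleftrightarrow> (\<forall>a b. N (a * b) \<le> N a * N b)"

definition nearly_absolute_value :: "('a::real_algebra \<Rightarrow> real) \<Rightarrow> bool" where
  "nearly_absolute_value N \<longleftrightarrow>
     vs_norm N \<and> submultiplicative N \<and> (\<exists>c>0. supermultiplicative c N)"

definition absolute_value :: "('a::real_algebra \<Rightarrow> real) \<Rightarrow> bool" where
  "absolute_value N \<longleftrightarrow> vs_norm N \<and> (\<forall>a b. N (a * b) = N a * N b)"

definition inner_product :: "('a::real_vector \<Rightarrow> 'a \<Rightarrow> real) \<Rightarrow> bool" where
  "inner_product ip \<longleftrightarrow> (\<forall>y. linear (\<lambda>x. ip x y)) \<and> (\<forall>x y. ip x y = ip y x) \<and>
     (\<forall>x. x \<noteq> 0 \<longrightarrow> 0 < ip x x)"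

definition is_natural_norm :: "('a::real_algebra \<Rightarrow> real) \<Rightarrow> bool" where
  "is_natural_norm N \<longleftrightarrow> vs_norm N \<and>
     (\<exists>ip. inner_product ip \<and> (\<forall>x. N x = sqrt (ip x x))) \<and>
     (\<forall>x. \<forall>k\<ge>1. N (apow x k) = N x ^ k)"

definition natural_norm :: "'a::real_algebra \<Rightarrow> real" where
  "natural_norm = (THE N. is_natural_norm N)"

definition topological_algebra :: "'a::real_algebra topology \<Rightarrow> bool" where
  "topological_algebra T \<longleftrightarrow> topspace T = UNIV \<and> Hausdorff_space T \<and>
     continuous_map (prod_topology T T) T (\<lambda>(x, y). x + y) \<and>
     continuous_map (prod_topology euclideanreal T) T (\<lambda>(r, x). r *\<^sub>R x) \<and>
     separately_continuous_mult T \<and>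
     continuous_map (subtopology T {x. invertible_element x}) T alg_inverse"

definition topological_dual :: "'a::real_vector topology \<Rightarrow> ('a \<Rightarrow> real) set" where
  "topological_dual T = {f. linear f \<and> continuous_map T euclideanreal f}"

definition dual_separates_points :: "'a::real_vector topology \<Rightarrow> bool" where
  "dual_separates_points T \<longleftrightarrow> (\<forall>x y. x \<noteq> y \<longrightarrow> (\<exists>f\<in>topological_dual T. f x \<noteq> f y))"

text \<open>Complex C*-algebras, not necessarily unital; the underlying real Banach algebra structure
  is the library's.\<close>

class cstar_algebra = banach + real_normed_algebra +
  fixes scaleC :: "complex \<Rightarrow> 'a \<Rightarrow> 'a"
    and cstar :: "'a \<Rightarrow> 'a"
  assumes scaleC_of_real: "scaleC (complex_of_real r) x = r *\<^sub>R x"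
    and scaleC_add_right: "scaleC c (x + y) = scaleC c x + scaleC c y"
    and scaleC_add_left: "scaleC (c + d) x = scaleC c x + scaleC d x"
    and scaleC_scaleC: "scaleC c (scaleC d x) = scaleC (c * d) x"
    and mult_scaleC_left: "scaleC c x * y = scaleC c (x * y)"
    and mult_scaleC_right: "x * scaleC c y = scaleC c (x * y)"
    and norm_scaleC: "norm (scaleC c x) = cmod c * norm x"
    and cstar_cstar: "cstar (cstar x) = x"
    and cstar_add: "cstar (x + y) = cstar x + cstar y"
    and cstar_scaleC: "cstar (scaleC c x) = scaleC (cnj c) (cstar x)"
    and cstar_mult: "cstar (x * y) = cstar y * cstar x"
    and norm_cstar_mult: "norm (cstar x * x) = (norm x)\<^sup>2"

text \<open>A normed algebra is a real C*-algebra inside \<^typ>\<open>'b\<close> if it is identified, via an isometric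
  embedding \<open>\<iota>\<close>, with a closed real *-subalgebra of \<^typ>\<open>'b\<close>. The ambient algebra is a type
  parameter, so a theorem assuming this predicate is quantified over all C*-algebras.\<close>

definition real_cstar_algebra :: "'b::cstar_algebra itself \<Rightarrow> ('a::real_algebra \<Rightarrow> real) \<Rightarrow> bool" where
  "real_cstar_algebra _ N \<longleftrightarrow> (\<exists>\<iota>::'a \<Rightarrow> 'b. linear \<iota> \<and> inj \<iota> \<and> (\<forall>x y. \<iota> (x * y) = \<iota> x * \<iota> y) \<and>
     (\<forall>x. norm (\<iota> x) = N x) \<and> closed (range \<iota>) \<and> cstar ` range \<iota> \<subseteq> range \<iota>)"

definition isometric_isomorphism ::
    "('a::real_algebra \<Rightarrow> real) \<Rightarrow> ('a \<Rightarrow> 'b::{real_algebra, real_normed_vector}) \<Rightarrow> bool" where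
  "isometric_isomorphism N f \<longleftrightarrow> linear f \<and> bij f \<and> (\<forall>x y. f (x * y) = f x * f y) \<and>
     (\<forall>x. norm (f x) = N x)"

definition isometric_to_RCH :: "('a::real_algebra \<Rightarrow> real) \<Rightarrow> bool" where
  "isometric_to_RCH N \<longleftrightarrow> (\<exists>f::'a \<Rightarrow> real. isometric_isomorphism N f) \<or>
     (\<exists>f::'a \<Rightarrow> complex. isometric_isomorphism N f) \<or>
     (\<exists>f::'a \<Rightarrow> quat. isometric_isomorphism N f)"

text \<open>The unique existence makes \<^const>\<open>natural_norm\<close> meaningful.\<close>

definition naturally_isometric_to_RCH :: "'a::real_algebra itself \<Rightarrow> bool" where
  "naturally_isometric_to_RCH _ \<longleftrightarrow> locally_complex TYPE('a) \<and>
     (\<exists>!N::'a \<Rightarrow> real. is_natural_norm N) \<and> isometric_to_RCH (natural_norm :: 'a \<Rightarrow> real)"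

end

theory Submission
  imports Defs "HOL-Complex_Analysis.Complex_Analysis"
    "HOL-Computational_Algebra.Fundamental_Theorem_Algebra"
begin

text \<open>
  Everything is reduced to one statement: if every \<open>a\<close> satisfies \<open>a\<^sup>3 = 2\<alpha>a\<^sup>2 - (\<alpha>\<^sup>2 + \<beta>\<^sup>2)a\<close> for some
  real \<open>\<alpha>, \<beta>\<close> and there are no nontrivial joint zero-divisors, then the cubic relation yields an
  idempotent, which must be a unit, and the classical argument of Frobenius applies. For algebraic
  algebras the relation comes from a complex root of an annihilating polynomial. For a norm without
  joint topological zero-divisors, left multiplication by \<open>a\<close> on the centralizer of \<open>a\<close> has an
  approximate quadratic eigenvalue \<open>q\<close>, and then \<open>q(a)a\<close> is a joint topological zero-divisor, hence
  zero. Quasi-division and supermultiplicativity exclude joint topological zero-divisors.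
  In the topological case one applies the Liouville theorem to the resolvent of \<open>a\<close> composed with a
  functional. Finally, a norm satisfying a power identity is determined by the powers
  \<open>x\<^bsup>k^m\<^esup>\<close>, because any two norms are equivalent on the span of \<open>1\<close> and \<open>x\<close>.
  A C*-norm satisfies such an identity, with \<open>k = 2\<close>, on the self-adjoint elements \<open>x\<^sup>* x\<close>.
\<close>

section \<open>A discrete maximum principle and polynomials in an operator on the complexification\<close>

text \<open>The obstacle is that neither completeness nor joint continuity of the product is given,
  so resolvents may fail to exist and cannot be expanded in power series. In the normed case
  Liouville's theorem is therefore replaced by a maximum principle for a real function,
  \<open>1 / sharp_bound l\<close>, that imitates the norm of the resolvent and whose mean value
  inequality rests on polynomial identities in the operator. The estimates live on the
  complexification, because a complex spectral value l is visible in the real algebra only through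
  the real polynomial q = (t - l)(t - cnj l). The centralizer is the right space: an approximate
  eigenvector that commutes with a makes its products with q(a)a small on both sides, whereas left
  multiplication on the whole algebra would control one side only. The factor a in q(a)a is forced
  by the missing unit, since q has a constant term; this is why the relation is cubic.\<close>

lemma discrete_maximum_principle:
  fixes f :: "complex \<Rightarrow> real"
  assumes cont: "continuous_on UNIV f"
    and lim: "(f \<longlongrightarrow> 0) at_infinity"
    and mean: "\<And>z r. 0 < r \<Longrightarrow>
      f z \<le> (f (z + of_real r) + f (z - of_real r) + f (z + \<i> * of_real r) + f (z - \<i> * of_real r)) / 4
              * (1 + r^4 * f z ^ 4)"
  shows "f z \<le> 0"
proof (rule ccontr)
  define m where "m = f z"
  assume "\<not> f z \<le> 0"
  then have m: "m > 0" by (simp add: m_def)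
  have "\<forall>\<^sub>F w in at_infinity. f w < m / 2"
    using order_tendstoD(2)[OF lim, of "m/2"] m by simp
  then obtain R0 where R0: "\<And>w. R0 \<le> norm w \<Longrightarrow> f w < m / 2"
    by (auto simp: eventually_at_infinity)
  define R where "R = max (max R0 (norm z)) 1"
  have R: "R \<ge> 1" "norm z \<le> R" "\<And>w. R \<le> norm w \<Longrightarrow> f w < m / 2"
    using R0 by (auto simp: R_def)
  \<comment> \<open>The term \<open>\<epsilon> * (norm w)^2\<close> adds at most m/4 on the disc, so
    h stays below 3m/4 on the boundary circle and attains its maximum inside.\<close>
  define \<epsilon> where "\<epsilon> = m / (4 * R^2)"
  have \<epsilon>: "\<epsilon> > 0" using m R(1) by (simp add: \<epsilon>_def)
  define h where "h w = f w + \<epsilon> * (norm w)^2" for w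
  have "continuous_on (cball 0 R) h"
    unfolding h_def by (intro continuous_intros continuous_on_subset[OF cont]) auto
  moreover have "compact (cball (0::complex) R)" "cball (0::complex) R \<noteq> {}"
    using R(1) by auto
  ultimately obtain w where w: "norm w \<le> R" "\<And>y. norm y \<le> R \<Longrightarrow> h y \<le> h w"
    using continuous_attains_sup[of "cball 0 R" h] by (auto simp: dist_norm)
  have hw: "h w \<ge> m"
    using w(2)[OF R(2)] \<epsilon> by (auto simp: h_def m_def intro: order_trans[rotated])
  have "norm w \<noteq> R"
  proof
    assume e: "norm w = R"
    then have "h w < m / 2 + \<epsilon> * R^2" using R(3)[of w] by (simp add: h_def)
    also have "\<dots> = m * 3 / 4" using R(1) by (simp add: \<epsilon>_def field_simps)
    finally show False using hw m by simp
  qed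
  then have wR: "norm w < R" using w(1) by simp
  define F where "F = f w"
  \<comment> \<open>At an interior maximum of h the four-point average of f is at most F -
    \<epsilon> r^2, since the average of the squared modulus exceeds its central value by exactly
    r^2. The factor 1 + r^4 F^4 is too close to 1 to make up for this loss as r tends to 0.\<close>
  have step: "\<epsilon> \<le> r^2 * F^5" if r: "0 < r" "r < R - norm w" for r
  proof -
    let ?r = "of_real r :: complex"
    have b: "norm (w + u) \<le> R" if "norm u = r" for u
      using norm_triangle_ineq[of w u] that r by simp
    have e: "f (w + u) \<le> F + \<epsilon> * (norm w)^2 - \<epsilon> * (norm (w+u))^2" if "norm u = r" for u
      using w(2)[OF b[OF that]] by (simp add: h_def F_def)
    have n: "norm ?r = r" "norm (-?r) = r" "norm (\<i> * ?r) = r" "norm (- (\<i> * ?r)) = r"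
      using r by (auto simp: norm_mult)
    have sq: "(norm (w + ?r))^2 + (norm (w - ?r))^2 + (norm (w + \<i> * ?r))^2 + (norm (w - \<i> * ?r))^2
       = 4 * (norm w)^2 + 4 * r^2"
      unfolding cmod_power2 by (simp add: power2_eq_square algebra_simps)
    define S where "S = (f (w + ?r) + f (w - ?r) + f (w + \<i> * ?r) + f (w - \<i> * ?r)) / 4"
    have "4 * S \<le> 4 * F + 4 * \<epsilon> * (norm w)^2 - \<epsilon> * ((norm (w + ?r))^2 + (norm (w - ?r))^2 + (norm (w + \<i> * ?r))^2 + (norm (w - \<i> * ?r))^2)"
    proof -
      have "4 * S = f (w + ?r) + f (w - ?r) + f (w + \<i> * ?r) + f (w - \<i> * ?r)"
        by (simp add: S_def)
      then show ?thesis
        using e[OF n(1)] e[OF n(2)] e[OF n(3)] e[OF n(4)] by (simp add: distrib_left)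
    qed
    then have S: "S \<le> F - \<epsilon> * r^2" unfolding sq by (simp add: algebra_simps)
    have "F \<le> S * (1 + r^4 * F^4)" using mean[OF r(1), of w] by (simp add: S_def F_def)
    also have "\<dots> \<le> (F - \<epsilon> * r^2) * (1 + r^4 * F^4)"
      using S by (intro mult_right_mono) auto
    also have "\<dots> = F - \<epsilon> * r^2 + r^2 * (r^2 * F^5) - \<epsilon> * r^2 * (r^4 * F^4)"
      by (simp add: algebra_simps power_def numeral_eq_Suc)
    also have "\<dots> \<le> F - \<epsilon> * r^2 + r^2 * (r^2 * F^5)"
      using \<epsilon> by simp
    finally have "r^2 * \<epsilon> \<le> r^2 * (r^2 * F^5)" by (simp add: algebra_simps)
    then show ?thesis using r by (subst (asm) mult_le_cancel_left_pos) auto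
  qed
  have "((\<lambda>r. r^2 * F^5) \<longlongrightarrow> 0^2 * F^5) (at_right (0::real))"
    by (intro tendsto_intros)
  moreover have "\<forall>\<^sub>F r in at_right 0. \<epsilon> \<le> r^2 * F^5"
    unfolding eventually_at_right_field using step wR by (intro exI[of _ "R - norm w"]) auto
  ultimately have "\<epsilon> \<le> 0^2 * F^5"
    by (rule tendsto_lowerbound) simp
  then show False using \<epsilon> by simp
qed

text \<open>A pair (x, y) stands for x + iy in the complexification of the real space. Then
  \<open>cpoly_act T p\<close> is p(T) for the complex-linear extension \<open>map_prod T T\<close>
  of T.\<close>

definition cscale :: "complex \<Rightarrow> 'v::real_vector \<times> 'v \<Rightarrow> 'v \<times> 'v" where
  "cscale c w = (Re c *\<^sub>R fst w - Im c *\<^sub>R snd w, Re c *\<^sub>R snd w + Im c *\<^sub>R fst w)"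

definition cpoly_act :: "('v::real_vector \<Rightarrow> 'v) \<Rightarrow> complex poly \<Rightarrow> 'v \<times> 'v \<Rightarrow> 'v \<times> 'v" where
  "cpoly_act T p w = (\<Sum>i\<le>degree p. cscale (coeff p i) ((map_prod T T ^^ i) w))"

lemma cscale_simps [simp]:
  "cscale 0 w = 0" "cscale 1 w = w" "cscale c 0 = 0"
  "cscale (of_real r) w = r *\<^sub>R w"
  by (auto simp: cscale_def prod_eq_iff)

lemma cscale_add_left: "cscale (c + d) w = cscale c w + cscale d w"
  by (simp add: cscale_def prod_eq_iff algebra_simps)

lemma cscale_add_right: "cscale c (w + v) = cscale c w + cscale c v"
  by (simp add: cscale_def prod_eq_iff algebra_simps)

lemma cscale_cscale: "cscale c (cscale d w) = cscale (c * d) w"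
  by (simp add: cscale_def prod_eq_iff algebra_simps)

lemma cscale_minus_left: "cscale (- c) w = - cscale c w"
  by (simp add: cscale_def prod_eq_iff)

lemma cscale_sum: "cscale c (\<Sum>i\<in>I. g i) = (\<Sum>i\<in>I. cscale c (g i))"
  by (induction I rule: infinite_finite_induct) (auto simp: cscale_add_right)

lemma linear_map_prod_same: "linear T \<Longrightarrow> linear (map_prod T T)"
  by (auto simp: linear_iff)

lemma map_prod_cscale: "linear T \<Longrightarrow> map_prod T T (cscale c w) = cscale c (map_prod T T w)"
  by (cases w) (simp add: cscale_def linear_add linear_diff linear_cmul)

lemma cpoly_act_altdef:
  assumes "degree p \<le> n"
  shows "cpoly_act T p w = (\<Sum>i\<le>n. cscale (coeff p i) ((map_prod T T ^^ i) w))"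
  unfolding cpoly_act_def using assms
  by (intro sum.mono_neutral_left) (auto simp: coeff_eq_0)

lemma cpoly_act_0 [simp]: "cpoly_act T 0 w = 0"
  by (simp add: cpoly_act_def)

lemma cpoly_act_1 [simp]: "cpoly_act T 1 w = w"
  by (simp add: cpoly_act_def)

lemma cpoly_act_pCons:
  assumes "linear T"
  shows "cpoly_act T (pCons c p) w = cscale c w + map_prod T T (cpoly_act T p w)"
proof -
  have "degree (pCons c p) \<le> Suc (degree p)" by (simp add: degree_pCons_le)
  from cpoly_act_altdef[OF this, of T w] show ?thesis
    by (simp add: sum.atMost_Suc_shift cpoly_act_def linear_sum[OF linear_map_prod_same[OF assms]]
        map_prod_cscale[OF assms] del: sum.atMost_Suc)
qed

lemma cpoly_act_add: "cpoly_act T (p + q) w = cpoly_act T p w + cpoly_act T q w"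
proof -
  define n where "n = max (degree p) (degree q)"
  have "degree p \<le> n" "degree q \<le> n" "degree (p + q) \<le> n"
    by (auto simp: n_def degree_add_le)
  then show ?thesis
    by (simp add: cpoly_act_altdef[of _ n] cscale_add_left sum.distrib)
qed

lemma cpoly_act_smult: "cpoly_act T (smult c p) w = cscale c (cpoly_act T p w)"
  by (simp add: cpoly_act_altdef[of "smult c p" "degree p"] cpoly_act_def cscale_sum cscale_cscale)

lemma cpoly_act_mult:
  assumes "linear T"
  shows "cpoly_act T (p * q) w = cpoly_act T p (cpoly_act T q w)"
  by (induction p)
     (simp_all add: cpoly_act_add cpoly_act_smult cpoly_act_pCons[OF assms])

lemma cpoly_act_linear_factor:
  assumes "linear T"
  shows "cpoly_act T [:- l, 1:] w = map_prod T T w - cscale l w"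
  by (simp add: cpoly_act_pCons[OF assms] cscale_minus_left linear_0[OF linear_map_prod_same[OF assms]])

lemma cpoly_act_zero [simp]: "linear T \<Longrightarrow> cpoly_act T p 0 = 0"
  by (induction p) (auto simp: cpoly_act_pCons linear_0[OF linear_map_prod_same])

lemma cpoly_act_closed:
  assumes "linear T" "subspace V" "T ` V \<subseteq> V" "w \<in> V \<times> V"
  shows "cpoly_act T p w \<in> V \<times> V"
proof (induction p)
  case (pCons c p)
  have "map_prod T T (cpoly_act T p w) \<in> V \<times> V"
    using pCons.IH assms(3) by (cases "cpoly_act T p w") auto
  moreover have "cscale c w \<in> V \<times> V"
    using assms(2,4) by (auto simp: cscale_def subspace_add subspace_diff subspace_scale)
  ultimately show ?case
    using assms(2) by (auto simp: cpoly_act_pCons[OF assms(1)] mem_Times_iff subspace_add)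
qed (use assms in \<open>auto simp: subspace_0 zero_prod_def\<close>)

text \<open>(T - cnj l)(T - l) has real coefficients and so acts on the two components separately.
  This is the passage from complex spectral values back to vectors of the real space.\<close>

lemma real_quadratic_of_complex_factor:
  assumes "linear T"
  shows "cpoly_act T [:- cnj l, 1:] (cpoly_act T [:- l, 1:] (x, y)) =
    (T (T x) - (2 * Re l) *\<^sub>R T x + ((Re l)\<^sup>2 + (Im l)\<^sup>2) *\<^sub>R x,
     T (T y) - (2 * Re l) *\<^sub>R T y + ((Re l)\<^sup>2 + (Im l)\<^sup>2) *\<^sub>R y)"
proof -
  have "(r * 2) *\<^sub>R v = r *\<^sub>R v + r *\<^sub>R v" for r and v :: 'a
    by (simp only: mult_2_right scaleR_left_distrib)
  then show ?thesis
    using assms by (simp add: cpoly_act_linear_factor cscale_def linear_add linear_diff linear_cmul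
        algebra_simps power2_eq_square)
qed

text \<open>Split off a root, p = (X - l) q: either q(T) already kills w and has smaller degree, or
  q(T) w is an eigenvector. Closure of V under T keeps it in \<open>V \<times> V\<close>.\<close>

lemma cpoly_kernel_linear_factor:
  assumes T: "linear T" and V: "subspace V" "T ` V \<subseteq> V"
    and p: "p \<noteq> 0" and w: "w \<in> V \<times> V" "w \<noteq> 0" and "cpoly_act T p w = 0"
  shows "\<exists>l. \<exists>v\<in>V \<times> V. v \<noteq> 0 \<and> cpoly_act T [:- l, 1:] v = 0"
  using p \<open>cpoly_act T p w = 0\<close>
proof (induction "degree p" arbitrary: p rule: less_induct)
  case less
  show ?case
  proof (cases "degree p = 0")
    case True
    then obtain c where "p = [:c:]" by (meson degree_eq_zeroE)
    then have "cscale c w = 0" "c \<noteq> 0" using less.prems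
      by (auto simp: cpoly_act_def)
    then have "cscale (inverse c) (cscale c w) = 0" by simp
    then have "w = 0" using \<open>c \<noteq> 0\<close> by (simp add: cscale_cscale)
    with w show ?thesis by simp
  next
    case False
    then obtain l where "poly p l = 0" using alg_closed_imp_poly_has_root[of p] by blast
    then obtain q where q: "p = [:- l, 1:] * q" by (auto simp: poly_eq_0_iff_dvd)
    have "q \<noteq> 0" using less.prems q by auto
    then have d: "degree q < degree p" unfolding q by (subst degree_mult_eq) auto
    show ?thesis
    proof (cases "cpoly_act T q w = 0")
      case True
      then show ?thesis using less.hyps[OF d \<open>q \<noteq> 0\<close>] by blast
    next
      case False
      moreover have "cpoly_act T [:- l, 1:] (cpoly_act T q w) = 0"
        using less.prems(2) unfolding q by (simp only: cpoly_act_mult[OF T])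
      ultimately show ?thesis using cpoly_act_closed[OF T V w(1)] by blast
    qed
  qed
qed

section \<open>Approximate quadratic eigenvalues\<close>

lemma vs_normD:
  assumes "vs_norm N"
  shows "0 \<le> N x" "N x = 0 \<longleftrightarrow> x = 0" "N (x + y) \<le> N x + N y" "N (r *\<^sub>R x) = \<bar>r\<bar> * N x"
    "N 0 = 0" "N (- x) = N x" "N (x - y) \<le> N x + N y"
proof -
  show "0 \<le> N x" "N x = 0 \<longleftrightarrow> x = 0" "N (x + y) \<le> N x + N y" "N (r *\<^sub>R x) = \<bar>r\<bar> * N x" "N 0 = 0"
    using assms by (auto simp: vs_norm_def)
  have m: "N (- x) = N x" for x
    using assms unfolding vs_norm_def by (metis abs_minus_cancel abs_one mult_1 scaleR_minus1_left)
  show "N (- x) = N x" by (rule m)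
  show "N (x - y) \<le> N x + N y"
    using assms m[of y] unfolding vs_norm_def by (metis add_uminus_conv_diff)
qed

text \<open>\<open>sharp_bound l\<close> replaces the norm of the inverse of \<open>T - l\<close>, which need not exist because neither
  completeness nor surjectivity is available: \<open>T - l\<close> is bounded below on the range of some
  injective polynomial in \<open>T\<close>, and such bounds survive multiplication by further polynomials.\<close>

locale operator_without_eigenvalues =
  fixes N :: "'v::real_vector \<Rightarrow> real" and T :: "'v \<Rightarrow> 'v" and V :: "'v set" and K :: real
  assumes N: "vs_norm N" and T: "linear T" and V: "subspace V" "T ` V \<subseteq> V"
    and K: "x \<in> V \<Longrightarrow> N (T x) \<le> K * N x"
    and nontrivial: "\<exists>x\<in>V. x \<noteq> 0"
    and bounded_below: "\<exists>\<epsilon>>0. \<forall>w\<in>V \<times> V. \<epsilon> * (N (fst w) + N (snd w)) \<le>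
      N (fst (cpoly_act T [:- l, 1:] w)) + N (snd (cpoly_act T [:- l, 1:] w))"
begin

text \<open>Only a real norm on the complexification: the sum is not homogeneous under complex
  scalars, which costs the factor 2 in \<open>pnorm_cscale\<close>.\<close>

definition pnorm :: "'v \<times> 'v \<Rightarrow> real" where
  "pnorm w = N (fst w) + N (snd w)"

definition inj_polys :: "complex poly set" where
  "inj_polys = {s. \<forall>w\<in>V \<times> V. cpoly_act T s w = 0 \<longrightarrow> w = 0}"

definition lower_bounds :: "complex \<Rightarrow> real set" where
  "lower_bounds l = {g. \<exists>s\<in>inj_polys. \<forall>w\<in>V \<times> V.
     g * pnorm (cpoly_act T s w) \<le> pnorm (cpoly_act T ([:- l, 1:] * s) w)}"

definition sharp_bound :: "complex \<Rightarrow> real" where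
  "sharp_bound l = Sup (lower_bounds l)"

lemma pnorm_nonneg: "0 \<le> pnorm w"
  using N by (auto simp: pnorm_def vs_norm_def)

lemma pnorm_eq_0: "pnorm w = 0 \<longleftrightarrow> w = 0"
  using vs_normD(1,2)[OF N] unfolding pnorm_def prod_eq_iff
  by (metis add_nonneg_eq_0_iff fst_zero snd_zero)

lemma pnorm_add: "pnorm (v + w) \<le> pnorm v + pnorm w"
  using vs_normD(3)[OF N, of "fst v" "fst w"] vs_normD(3)[OF N, of "snd v" "snd w"]
  by (simp add: pnorm_def)

lemma pnorm_diff: "pnorm (v - w) \<le> pnorm v + pnorm w"
  using vs_normD(7)[OF N, of "fst v" "fst w"] vs_normD(7)[OF N, of "snd v" "snd w"]
  by (simp add: pnorm_def)

lemma pnorm_scaleR: "pnorm (r *\<^sub>R w) = \<bar>r\<bar> * pnorm w"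
  by (simp add: pnorm_def vs_normD(4)[OF N] distrib_left)

lemma pnorm_cscale: "pnorm (cscale c w) \<le> 2 * cmod c * pnorm w"
proof -
  let ?a = "N (fst w)" and ?b = "N (snd w)"
  have "pnorm (cscale c w) \<le> (\<bar>Re c\<bar> * ?a + \<bar>Im c\<bar> * ?b) + (\<bar>Re c\<bar> * ?b + \<bar>Im c\<bar> * ?a)"
    unfolding pnorm_def cscale_def fst_conv snd_conv vs_normD(4)[OF N, symmetric]
    by (intro add_mono vs_normD[OF N])
  also have "\<dots> = (\<bar>Re c\<bar> + \<bar>Im c\<bar>) * pnorm w"
    by (simp add: pnorm_def algebra_simps)
  also have "\<dots> \<le> (cmod c + cmod c) * pnorm w"
    by (intro mult_right_mono add_mono abs_Re_le_cmod abs_Im_le_cmod pnorm_nonneg)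
  finally show ?thesis by simp
qed

lemma pnorm_T: "w \<in> V \<times> V \<Longrightarrow> pnorm (map_prod T T w) \<le> K * pnorm w"
  using K[of "fst w"] K[of "snd w"] by (auto simp: pnorm_def distrib_left)

lemma act_closed: "w \<in> V \<times> V \<Longrightarrow> cpoly_act T p w \<in> V \<times> V"
  by (rule cpoly_act_closed[OF T V])

lemma inj_polys_mult: "s \<in> inj_polys \<Longrightarrow> t \<in> inj_polys \<Longrightarrow> s * t \<in> inj_polys"
  using act_closed unfolding inj_polys_def cpoly_act_mult[OF T] mem_Collect_eq by blast

lemma inj_polys_1: "1 \<in> inj_polys"
  by (simp add: inj_polys_def)

lemma inj_polys_power: "s \<in> inj_polys \<Longrightarrow> s ^ n \<in> inj_polys"
  by (induction n) (auto simp: inj_polys_1 inj_polys_mult)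

lemma inj_polys_linear: "[:- l, 1:] \<in> inj_polys"
  unfolding inj_polys_def
proof (safe)
  fix x y assume w: "x \<in> V" "y \<in> V" and z: "cpoly_act T [:- l, 1:] (x, y) = 0"
  obtain e where "e > 0" "e * pnorm (x, y) \<le> 0"
    using bounded_below[of l] w z by (fastforce simp: pnorm_def vs_normD(5)[OF N])
  then have "pnorm (x, y) = 0"
    using pnorm_nonneg[of "(x, y)"] by (simp add: mult_le_0_iff)
  then show "(x, y) = 0" by (simp add: pnorm_eq_0)
qed

lemma pnorm_linear_upper:
  "w \<in> V \<times> V \<Longrightarrow> pnorm (cpoly_act T [:- l, 1:] w) \<le> (K + 2 * cmod l) * pnorm w"
  using pnorm_diff[of "map_prod T T w" "cscale l w"] pnorm_T[of w] pnorm_cscale[of l w]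
  by (simp add: cpoly_act_linear_factor[OF T] distrib_right)

text \<open>For q = s t the bound is applied to t(T) w. Hence bounds at several points hold
  simultaneously on multiples of the product of their polynomials, and that product stays injective
  by \<open>inj_polys_mult\<close>.\<close>

lemma lower_bounds_dvd:
  assumes "g \<in> lower_bounds l"
  obtains s where "s \<in> inj_polys" "\<And>q w. s dvd q \<Longrightarrow> w \<in> V \<times> V \<Longrightarrow>
    g * pnorm (cpoly_act T q w) \<le> pnorm (cpoly_act T ([:- l, 1:] * q) w)"
proof -
  obtain s where s: "s \<in> inj_polys" "\<And>w. w \<in> V \<times> V \<Longrightarrow>
     g * pnorm (cpoly_act T s w) \<le> pnorm (cpoly_act T ([:- l, 1:] * s) w)"
    using assms by (auto simp: lower_bounds_def)
  show ?thesis
  proof (rule that[OF s(1)])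
    fix q w assume "s dvd q" "w \<in> V \<times> V"
    then obtain t where t: "q = s * t" by blast
    show "g * pnorm (cpoly_act T q w) \<le> pnorm (cpoly_act T ([:- l, 1:] * q) w)"
      using s(2)[OF act_closed[OF \<open>w \<in> V \<times> V\<close>, of t]]
      unfolding t mult.assoc[symmetric] cpoly_act_mult[OF T] .
  qed
qed

lemma lower_bounds_mono:
  assumes "g \<in> lower_bounds l" "h \<le> g"
  shows "h \<in> lower_bounds l"
proof -
  obtain s where s: "s \<in> inj_polys" "\<And>w. w \<in> V \<times> V \<Longrightarrow>
     g * pnorm (cpoly_act T s w) \<le> pnorm (cpoly_act T ([:- l, 1:] * s) w)"
    using assms by (auto simp: lower_bounds_def)
  have "h * pnorm (cpoly_act T s w) \<le> g * pnorm (cpoly_act T s w)" for w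
    using assms(2) pnorm_nonneg by (rule mult_right_mono)
  then show ?thesis
    using s unfolding lower_bounds_def by (blast intro: order_trans)
qed

text \<open>Injectivity of s and \<open>nontrivial\<close> supply a nonzero vector in the range of
  s(T), where a lower bound for T - l cannot exceed the upper one. This makes the supremum in
  \<open>sharp_bound\<close> finite.\<close>

lemma lower_bounds_upper:
  assumes "g \<in> lower_bounds l"
  shows "g \<le> K + 2 * cmod l"
proof -
  obtain s where s: "s \<in> inj_polys" "\<And>w. w \<in> V \<times> V \<Longrightarrow>
     g * pnorm (cpoly_act T s w) \<le> pnorm (cpoly_act T ([:- l, 1:] * s) w)"
    using assms by (auto simp: lower_bounds_def)
  obtain x where x: "x \<in> V" "x \<noteq> 0" using nontrivial by blast
  define w where "w = cpoly_act T s (x, 0)"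
  have x0: "(x, 0) \<in> V \<times> V" using x V by (auto simp: subspace_0)
  then have "w \<noteq> 0" "w \<in> V \<times> V"
    using s(1) x act_closed[OF x0] by (auto simp: w_def inj_polys_def zero_prod_def)
  then have pos: "pnorm w > 0" using pnorm_nonneg[of w] pnorm_eq_0[of w] by linarith
  have "g * pnorm w \<le> pnorm (cpoly_act T [:- l, 1:] w)"
    using s(2)[OF x0] by (simp only: w_def cpoly_act_mult[OF T])
  also have "\<dots> \<le> (K + 2 * cmod l) * pnorm w"
    using \<open>w \<in> V \<times> V\<close> by (rule pnorm_linear_upper)
  finally show ?thesis using pos by simp
qed

lemma bdd_above_lower_bounds: "bdd_above (lower_bounds l)"
  using lower_bounds_upper by (meson bdd_aboveI)

lemma lower_bounds_le_sharp: "g \<in> lower_bounds l \<Longrightarrow> g \<le> sharp_bound l"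
  unfolding sharp_bound_def by (rule cSup_upper[OF _ bdd_above_lower_bounds])

lemma lower_boundsI_1:
  assumes "\<And>w. w \<in> V \<times> V \<Longrightarrow> g * pnorm w \<le> pnorm (cpoly_act T [:- l, 1:] w)"
  shows "g \<in> lower_bounds l"
  unfolding lower_bounds_def using inj_polys_1 assms
  by (intro CollectI bexI[of _ 1]) auto

lemma sharp_bound_pos: "0 < sharp_bound l"
proof -
  obtain e where "e > 0" "\<And>w. w \<in> V \<times> V \<Longrightarrow> e * pnorm w \<le> pnorm (cpoly_act T [:- l, 1:] w)"
    using bounded_below[of l] by (auto simp: pnorm_def)
  then show ?thesis using lower_bounds_le_sharp[OF lower_boundsI_1] by fastforce
qed

lemma less_sharp_bound: "g < sharp_bound l \<Longrightarrow> g \<in> lower_bounds l"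
proof -
  assume g: "g < sharp_bound l"
  have "lower_bounds l \<noteq> {}"
    using lower_boundsI_1 bounded_below[of l] by (fastforce simp: pnorm_def)
  then obtain h where "h \<in> lower_bounds l" "g < h"
    using less_cSup_iff[OF _ bdd_above_lower_bounds] g unfolding sharp_bound_def by blast
  then show ?thesis using lower_bounds_mono by simp
qed

text \<open>For large l the scalar part of T - l dominates, which makes
  \<open>1 / sharp_bound\<close> vanish at infinity. The 1/2 comes from applying
  \<open>pnorm_cscale\<close> to \<open>inverse l\<close>.\<close>

lemma sharp_bound_ge: "cmod l / 2 - K \<le> sharp_bound l"
proof (rule lower_bounds_le_sharp, rule lower_boundsI_1)
  fix w assume w: "w \<in> V \<times> V"
  have "cmod l / 2 * pnorm w \<le> pnorm (cscale l w)"
  proof (cases "l = 0")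
    case False
    have "pnorm w \<le> 2 * cmod (inverse l) * pnorm (cscale l w)"
      using pnorm_cscale[of "inverse l" "cscale l w"] False by (simp add: cscale_cscale)
    then show ?thesis using False by (simp add: norm_divide field_simps)
  qed (simp add: pnorm_nonneg)
  also have "cscale l w = map_prod T T w - cpoly_act T [:- l, 1:] w"
    by (simp add: cpoly_act_linear_factor[OF T])
  also have "pnorm \<dots> \<le> K * pnorm w + pnorm (cpoly_act T [:- l, 1:] w)"
    using pnorm_diff pnorm_T[OF w] by (meson add_right_mono order_trans)
  finally show "(cmod l / 2 - K) * pnorm w \<le> pnorm (cpoly_act T [:- l, 1:] w)"
    by (simp add: left_diff_distrib)
qed

text \<open>T - l and T - m differ by a scalar, so the polynomial witnessing a bound at l also
  witnesses one at m, weaker by at most 2|l - m|.\<close>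

lemma sharp_bound_lipschitz: "\<bar>sharp_bound l - sharp_bound m\<bar> \<le> 2 * cmod (l - m)"
proof -
  have *: "sharp_bound l \<le> sharp_bound m + 2 * cmod (l - m)" for l m
  proof (rule dense_le)
    fix g assume "g < sharp_bound l"
    then obtain s where s: "s \<in> inj_polys" "\<And>q w. s dvd q \<Longrightarrow> w \<in> V \<times> V \<Longrightarrow>
        g * pnorm (cpoly_act T q w) \<le> pnorm (cpoly_act T ([:- l, 1:] * q) w)"
      using less_sharp_bound lower_bounds_dvd by blast
    have "(g - 2 * cmod (l - m)) * pnorm (cpoly_act T s w) \<le> pnorm (cpoly_act T ([:- m, 1:] * s) w)"
      if w: "w \<in> V \<times> V" for w
    proof -
      have "[:- l, 1:] * s = [:- m, 1:] * s + smult (m - l) s"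
        by (simp add: smult_diff_left)
      then have "pnorm (cpoly_act T ([:- l, 1:] * s) w) \<le>
          pnorm (cpoly_act T ([:- m, 1:] * s) w) + pnorm (cscale (m - l) (cpoly_act T s w))"
        by (metis cpoly_act_add cpoly_act_smult pnorm_add)
      then show ?thesis
        using s(2)[OF dvd_refl w] pnorm_cscale[of "m - l" "cpoly_act T s w"]
        by (simp add: left_diff_distrib norm_minus_commute)
    qed
    then have "g - 2 * cmod (l - m) \<in> lower_bounds m"
      using s(1) by (auto simp: lower_bounds_def)
    from lower_bounds_le_sharp[OF this] show "g \<le> sharp_bound m + 2 * cmod (l - m)" by simp
  qed
  show ?thesis using *[of l m] *[of m l] by (simp add: abs_le_iff norm_minus_commute)
qed

text \<open>The mean value inequality for the resolvent. Writing \<open>B = T - z\<close> and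
  \<open>B\<^sub>k\<close> for \<open>T - z\<close> shifted by the four points \<open>\<plusminus>r\<close>, \<open>\<plusminus>\<i>r\<close>, it comes from
  \<open>\<Prod>B\<^sub>k = B\<^sup>4 - r\<^sup>4\<close> and its logarithmic derivative.\<close>

lemma lower_bounds_four_points:
  fixes z :: complex and r :: real
  defines "R \<equiv> of_real r :: complex"
  assumes g: "g0 \<in> lower_bounds z" "g1 \<in> lower_bounds (z + R)" "g2 \<in> lower_bounds (z - R)"
      "g3 \<in> lower_bounds (z + \<i> * R)" "g4 \<in> lower_bounds (z - \<i> * R)"
    and pos: "0 < g0" "0 < g1" "0 < g2" "0 < g3" "0 < g4"
  shows "1 / sharp_bound z \<le> (1 / g1 + 1 / g2 + 1 / g3 + 1 / g4) / 4 * (1 + r^4 / g0^4)"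
proof -
  obtain s0 where s0: "s0 \<in> inj_polys" "\<And>q w. s0 dvd q \<Longrightarrow> w \<in> V \<times> V \<Longrightarrow>
    g0 * pnorm (cpoly_act T q w) \<le> pnorm (cpoly_act T ([:- z, 1:] * q) w)"
    using lower_bounds_dvd[OF g(1)] by metis
  obtain s1 where s1: "s1 \<in> inj_polys" "\<And>q w. s1 dvd q \<Longrightarrow> w \<in> V \<times> V \<Longrightarrow>
    g1 * pnorm (cpoly_act T q w) \<le> pnorm (cpoly_act T ([:- (z + R), 1:] * q) w)"
    using lower_bounds_dvd[OF g(2)] by metis
  obtain s2 where s2: "s2 \<in> inj_polys" "\<And>q w. s2 dvd q \<Longrightarrow> w \<in> V \<times> V \<Longrightarrow>
    g2 * pnorm (cpoly_act T q w) \<le> pnorm (cpoly_act T ([:- (z - R), 1:] * q) w)"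
    using lower_bounds_dvd[OF g(3)] by metis
  obtain s3 where s3: "s3 \<in> inj_polys" "\<And>q w. s3 dvd q \<Longrightarrow> w \<in> V \<times> V \<Longrightarrow>
    g3 * pnorm (cpoly_act T q w) \<le> pnorm (cpoly_act T ([:- (z + \<i> * R), 1:] * q) w)"
    using lower_bounds_dvd[OF g(4)] by metis
  obtain s4 where s4: "s4 \<in> inj_polys" "\<And>q w. s4 dvd q \<Longrightarrow> w \<in> V \<times> V \<Longrightarrow>
    g4 * pnorm (cpoly_act T q w) \<le> pnorm (cpoly_act T ([:- (z - \<i> * R), 1:] * q) w)"
    using lower_bounds_dvd[OF g(5)] by metis
  \<comment> \<open>A common multiple of the five witnesses: all five bounds hold on multiples of
    s.\<close>
  define s where "s = s0 * s1 * s2 * s3 * s4"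
  have dvd: "s0 dvd p * s" "s1 dvd p * s" "s2 dvd p * s" "s3 dvd p * s" "s4 dvd p * s" for p
    by (auto simp: s_def)
  have s: "s \<in> inj_polys"
    unfolding s_def by (intro inj_polys_mult s0 s1 s2 s3 s4)
  define B B1 B2 B3 B4 where B: "B = [:- z, 1:]" "B1 = [:- (z + R), 1:]" "B2 = [:- (z - R), 1:]"
    "B3 = [:- (z + \<i> * R), 1:]" "B4 = [:- (z - \<i> * R), 1:]"
  define P where "P = B1 * B2 * B3 * B4"
  \<comment> \<open>The numbers r and i become constant polynomials, so that the shifts are handled
    by ring identities with j * j = -1 as the only fact about i.\<close>
  define c where "c = [:R:]"
  define j where "j = [:\<i>:]"
  have j: "j * j = -1" by (simp add: j_def one_pCons)
  have Bs: "B1 = B - c" "B2 = B + c" "B3 = B - j * c" "B4 = B + j * c"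
    by (simp_all add: B c_def j_def)
  have B34: "B3 * B4 = B * B + c * c"
  proof -
    have "B3 * B4 = B * B - (j * j) * (c * c)" unfolding Bs by (simp add: algebra_simps)
    then show ?thesis by (simp add: j)
  qed
  have B12: "B1 * B2 = B * B - c * c" unfolding Bs by (simp add: algebra_simps)
  have I1: "4 * B ^ 3 = B2 * B3 * B4 + B1 * B3 * B4 + B1 * B2 * B4 + B1 * B2 * B3"
  proof -
    have "B2 * B3 * B4 + B1 * B3 * B4 + B1 * B2 * B4 + B1 * B2 * B3 =
      (B1 + B2) * (B3 * B4) + (B1 * B2) * (B3 + B4)" by (simp add: algebra_simps)
    also have "\<dots> = 4 * B ^ 3" unfolding B12 B34 by (simp add: Bs algebra_simps power3_eq_cube)
    finally show ?thesis by simp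
  qed
  have I2: "P = B ^ 4 - smult (of_real (r^4)) 1"
  proof -
    have "P = (B1 * B2) * (B3 * B4)" by (simp add: P_def mult.assoc)
    also have "\<dots> = B ^ 4 - c ^ 4" unfolding B12 B34 by (simp add: algebra_simps power_def numeral_eq_Suc)
    also have "c ^ 4 = smult (of_real (r^4)) 1"
      by (simp add: c_def poly_const_pow R_def one_pCons)
    finally show ?thesis .
  qed
  define C where "C = (1 / g1 + 1 / g2 + 1 / g3 + 1 / g4) / 4 * (1 + r^4 / g0^4)"
  have "(1 / g1 + 1 / g2 + 1 / g3 + 1 / g4) > 0" "1 + r^4 / g0^4 > 0"
    using pos by (auto intro!: add_pos_pos add_pos_nonneg)
  then have C: "C > 0" by (simp add: C_def)
  \<comment> \<open>Formally B^-1 = 1/4 (B1^-1 + B2^-1 + B3^-1 + B4^-1)(1 - r^4 B^-4), because B^4 -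
    r^4 = P and 4 B^3 is the sum of the triple products. Norms of the right side give C. On vectors
    of the form B^4 P s w all these inverses are honest polynomials, which explains the witness
    \<open>P * B ^ 3 * s\<close>.\<close>
  have "inverse C \<in> lower_bounds z"
    unfolding lower_bounds_def
  proof (intro CollectI bexI[of _ "P * B ^ 3 * s"] ballI)
    show "P * B ^ 3 * s \<in> inj_polys"
      unfolding P_def B by (intro inj_polys_mult inj_polys_power inj_polys_linear s)
    fix w assume w: "w \<in> V \<times> V"
    define m where "m q = pnorm (cpoly_act T q w)" for q
    have m_add: "m (p + q) \<le> m p + m q" and m_diff: "m (p - q) \<le> m p + m q" for p q
    proof -
      show "m (p + q) \<le> m p + m q" by (simp add: m_def cpoly_act_add pnorm_add)
      have "cpoly_act T (p - q) w = cpoly_act T p w - cpoly_act T q w"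
        by (metis add_diff_cancel cpoly_act_add diff_add_cancel)
      then show "m (p - q) \<le> m p + m q" by (simp add: m_def pnorm_diff)
    qed
    \<comment> \<open>Only the real scalars 4 and r^4 are pulled out of the norm. A factor 2 from a
      complex scalar would ruin the mean value inequality, whose leading constant must be exactly
      1.\<close>
    have m_smult: "m (smult (of_real t) q) = \<bar>t\<bar> * m q" for t q
      by (simp only: m_def cpoly_act_smult cscale_simps pnorm_scaleR)
    have g0: "m (q * s) \<le> 1 / g0 * m (B * q * s)" and g1: "m (q * s) \<le> 1 / g1 * m (B1 * q * s)"
      and g2: "m (q * s) \<le> 1 / g2 * m (B2 * q * s)" and g3: "m (q * s) \<le> 1 / g3 * m (B3 * q * s)"
      and g4: "m (q * s) \<le> 1 / g4 * m (B4 * q * s)" for q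
      using s0(2)[OF dvd(1) w, of q] s1(2)[OF dvd(2) w, of q] s2(2)[OF dvd(3) w, of q]
        s3(2)[OF dvd(4) w, of q] s4(2)[OF dvd(5) w, of q] pos
      by (simp_all only: m_def B mult.assoc) (simp_all add: field_simps)
    have "m (P * s) \<le> 1 / g0 * (1 / g0 * (1 / g0 * (1 / g0 * m (B * (B * (B * (B * P))) * s))))"
      using pos(1)
      by (intro order_trans[OF g0] mult_left_mono order_refl) auto
    also have "\<dots> = 1 / g0 ^ 4 * m (B * (P * B ^ 3 * s))"
      by (simp add: power_def numeral_eq_Suc mult_ac)
    finally have Ps: "m (P * s) \<le> 1 / g0 ^ 4 * m (B * (P * B ^ 3 * s))" .
    have "m (P * P * s) \<le> m (B * (P * B ^ 3 * s)) + m (smult (of_real (r^4)) (P * s))"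
    proof -
      have "P * P * s = B * (P * B ^ 3 * s) - smult (of_real (r^4)) (P * s)"
        by (subst (1) I2) (simp add: algebra_simps power_def numeral_eq_Suc)
      then show ?thesis using m_diff by metis
    qed
    also have "\<dots> = m (B * (P * B ^ 3 * s)) + r^4 * m (P * s)"
      unfolding m_smult by simp
    also have "\<dots> \<le> m (B * (P * B ^ 3 * s)) + r^4 * (1 / g0 ^ 4 * m (B * (P * B ^ 3 * s)))"
      by (intro add_left_mono mult_left_mono Ps) auto
    finally have PPs: "m (P * P * s) \<le> (1 + r^4 / g0^4) * m (B * (P * B ^ 3 * s))"
      by (simp add: distrib_right)
    have "4 * m (P * B ^ 3 * s) = m (smult (of_real 4) (P * B ^ 3 * s))"
      unfolding m_smult by simp
    also have "smult (of_real 4) (P * B ^ 3 * s) = (4 * B ^ 3) * P * s"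
      by (simp add: numeral_poly mult_ac)
    also have "\<dots> = (B2 * B3 * B4 * P) * s + (B1 * B3 * B4 * P) * s + (B1 * B2 * B4 * P) * s
        + (B1 * B2 * B3 * P) * s"
      unfolding I1 by (simp only: distrib_right)
    also have "m \<dots> \<le> m ((B2 * B3 * B4 * P) * s) + m ((B1 * B3 * B4 * P) * s)
        + m ((B1 * B2 * B4 * P) * s) + m ((B1 * B2 * B3 * P) * s)"
      by (intro order_trans[OF m_add] add_right_mono order_refl)
    also have "\<dots> \<le> 1 / g1 * m (B1 * (B2 * B3 * B4 * P) * s) + 1 / g2 * m (B2 * (B1 * B3 * B4 * P) * s)
        + 1 / g3 * m (B3 * (B1 * B2 * B4 * P) * s) + 1 / g4 * m (B4 * (B1 * B2 * B3 * P) * s)"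
      by (intro add_mono g1 g2 g3 g4)
    also have "\<dots> = (1 / g1 + 1 / g2 + 1 / g3 + 1 / g4) * m (P * P * s)"
      by (simp add: P_def mult_ac distrib_right)
    also have "\<dots> \<le> (1 / g1 + 1 / g2 + 1 / g3 + 1 / g4) * ((1 + r^4 / g0^4) * m (B * (P * B ^ 3 * s)))"
      using pos by (intro mult_left_mono PPs) auto
    finally have "m (P * B ^ 3 * s) \<le> C * m (B * (P * B ^ 3 * s))"
      by (simp add: C_def)
    then have "inverse C * m (P * B ^ 3 * s) \<le> m (B * (P * B ^ 3 * s))"
      using C by (simp add: field_simps)
    then show "inverse C * pnorm (cpoly_act T (P * B ^ 3 * s) w) \<le>
        pnorm (cpoly_act T ([:- z, 1:] * (P * B ^ 3 * s)) w)"
      by (simp only: m_def B)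
  qed
  from lower_bounds_le_sharp[OF this] have "1 / sharp_bound z \<le> C"
    using C sharp_bound_pos[of z] by (simp add: field_simps)
  then show ?thesis by (simp only: C_def)
qed

text \<open>The supremum need not be attained, so the smaller bounds
  \<open>t * sharp_bound l\<close> with t < 1 are inserted and t tends to 1.\<close>

lemma sharp_bound_mean_value:
  fixes z :: complex and r :: real
  defines "R \<equiv> of_real r :: complex" and "f \<equiv> \<lambda>l. 1 / sharp_bound l"
  shows "f z \<le> (f (z + R) + f (z - R) + f (z + \<i> * R) + f (z - \<i> * R)) / 4 * (1 + r^4 * f z ^ 4)"
proof -
  define h where "h t = (f (z + R) / t + f (z - R) / t + f (z + \<i> * R) / t + f (z - \<i> * R) / t) / 4
    * (1 + r^4 * (f z / t) ^ 4)" for t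
  have "(h \<longlongrightarrow> h 1) (at_left (1::real))"
    unfolding h_def by (intro tendsto_intros) auto
  moreover have "\<forall>\<^sub>F t in at_left 1. f z \<le> h t"
    unfolding eventually_at_left_field
  proof (intro exI[of _ 0] conjI allI impI)
    fix t :: real assume t: "0 < t" "t < 1"
    have lb: "t * sharp_bound l \<in> lower_bounds l" "0 < t * sharp_bound l" for l
      using t sharp_bound_pos[of l] by (auto intro!: less_sharp_bound)
    show "f z \<le> h t"
      using lower_bounds_four_points[of "t * sharp_bound z" z _ r, folded R_def, OF lb(1) lb(1) lb(1) lb(1) lb(1)
          lb(2) lb(2) lb(2) lb(2) lb(2)]
      by (simp add: h_def f_def power_divide power_mult_distrib mult.commute)
  qed auto
  ultimately have "f z \<le> h 1"
    by (rule tendsto_lowerbound) auto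
  then show ?thesis by (simp add: h_def)
qed

text \<open>The positive function \<open>1 / sharp_bound\<close> meets all hypotheses of
  \<open>discrete_maximum_principle\<close>, which forces it to be at most 0.\<close>

lemma contradiction: False
proof -
  define f where "f l = 1 / sharp_bound l" for l
  have "continuous_on UNIV sharp_bound"
  proof (rule lipschitz_on_continuous_on[of 2], rule lipschitz_onI)
    show "dist (sharp_bound x) (sharp_bound y) \<le> 2 * dist x y" for x y
      using sharp_bound_lipschitz[of x y] by (simp add: dist_norm)
  qed simp
  moreover have "sharp_bound l \<noteq> 0" for l
    using sharp_bound_pos[of l] by simp
  ultimately have cont: "continuous_on UNIV f"
    unfolding f_def by (intro continuous_intros) auto
  have "filterlim (\<lambda>t. t / 2 - K) at_top at_top"
    by real_asymp
  then have "filterlim (\<lambda>l. cmod l / 2 - K) at_top at_infinity"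
    using filterlim_norm_at_top by (rule filterlim_compose)
  then have "filterlim sharp_bound at_top at_infinity"
    by (rule filterlim_at_top_mono) (simp add: sharp_bound_ge)
  then have "(f \<longlongrightarrow> 0) at_infinity"
    unfolding f_def by (intro tendsto_divide_0[OF tendsto_const] filterlim_at_top_imp_at_infinity)
  from discrete_maximum_principle[OF cont this, of 0] have "f 0 \<le> 0"
    using sharp_bound_mean_value by (simp add: f_def)
  then show False using sharp_bound_pos[of 0] by (simp add: f_def)
qed

end

text \<open>If every such quadratic in T were bounded below, each T - l would be too: the product (T
  - cnj l)(T - l) is bounded below and T - cnj l is bounded above. That is the situation refuted in
  the locale.\<close>

lemma approximate_quadratic_eigenvalue:
  fixes N :: "'v::real_vector \<Rightarrow> real"
  assumes N: "vs_norm N" and T: "linear T" and V: "subspace V" "T ` V \<subseteq> V"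
    and K: "\<And>x. x \<in> V \<Longrightarrow> N (T x) \<le> K * N x"
    and nontrivial: "\<exists>x\<in>V. x \<noteq> 0"
  shows "\<exists>\<alpha> \<beta>. \<forall>\<epsilon>>0. \<exists>x\<in>V. x \<noteq> 0 \<and>
    N (T (T x) - (2 * \<alpha>) *\<^sub>R T x + (\<alpha>\<^sup>2 + \<beta>\<^sup>2) *\<^sub>R x) \<le> \<epsilon> * N x"
proof (rule ccontr)
  assume neg: "\<not> ?thesis"
  have "operator_without_eigenvalues N T V K"
  proof (rule operator_without_eigenvalues.intro)
    fix l :: complex
    define Q where "Q x = T (T x) - (2 * Re l) *\<^sub>R T x + ((Re l)\<^sup>2 + (Im l)\<^sup>2) *\<^sub>R x" for x
    from neg obtain e where e: "e > 0" "\<And>x. x \<in> V \<Longrightarrow> x \<noteq> 0 \<Longrightarrow> e * N x < N (Q x)"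
      unfolding Q_def by (metis not_le)
    have e': "e * N x \<le> N (Q x)" if "x \<in> V" for x
      using e(2)[OF that] vs_normD(1,5)[OF N] by (cases "x = 0") (auto intro: less_imp_le)
    define M where "M w = N (fst w) + N (snd w)" for w :: "'v \<times> 'v"
    \<comment> \<open>An upper bound for T - cnj l on the complexification; the summand 1 makes it
      positive, so that e / c is a legitimate lower bound for T - l.\<close>
    define c where "c = \<bar>K\<bar> + 2 * cmod l + 1"
    have c: "c > 0" unfolding c_def by (smt (verit) norm_ge_zero)
    have upper: "M (cpoly_act T [:- cnj l, 1:] w) \<le> c * M w" if wV: "w \<in> V \<times> V" for w
    proof -
      obtain x y where w: "w = (x, y)" "x \<in> V" "y \<in> V" using wV by (cases w) auto
      have n: "0 \<le> N x" "0 \<le> N y" by (auto simp: vs_normD(1)[OF N])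
      have q: "N (T x - u) \<le> N (T x) + N u" for x u by (rule vs_normD(7)[OF N])
      have "M (cpoly_act T [:- cnj l, 1:] w) \<le>
        (N (T x) + (\<bar>Re l\<bar> * N x + \<bar>Im l\<bar> * N y)) + (N (T y) + (\<bar>Re l\<bar> * N y + \<bar>Im l\<bar> * N x))"
        unfolding M_def cpoly_act_linear_factor[OF T] cscale_def w vs_normD(4)[OF N, symmetric]
        by (simp, intro add_mono order_trans[OF q] add_left_mono order_refl order_trans[OF vs_normD(3)[OF N]]
            order_trans[OF vs_normD(7)[OF N]])
      also have "\<dots> \<le> (K * N x + (cmod l * N x + cmod l * N y)) + (K * N y + (cmod l * N y + cmod l * N x))"
        by (intro add_mono K w mult_right_mono abs_Re_le_cmod abs_Im_le_cmod n)
      also have "\<dots> = (K + 2 * cmod l) * M w" by (simp add: M_def w algebra_simps)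
      also have "\<dots> \<le> c * M w"
        using n by (intro mult_right_mono) (auto simp: c_def M_def w)
      finally show ?thesis .
    qed
    have "e / c * M w \<le> M (cpoly_act T [:- l, 1:] w)" if wV: "w \<in> V \<times> V" for w
    proof -
      obtain x y where w: "w = (x, y)" "x \<in> V" "y \<in> V" using wV by (cases w) auto
      have "e * M w \<le> M (Q x, Q y)"
        using e'[OF w(2)] e'[OF w(3)] by (simp add: M_def w distrib_left)
      also have "(Q x, Q y) = cpoly_act T [:- cnj l, 1:] (cpoly_act T [:- l, 1:] w)"
        unfolding w(1) real_quadratic_of_complex_factor[OF T] Q_def ..
      also have "M \<dots> \<le> c * M (cpoly_act T [:- l, 1:] w)"
        by (intro upper cpoly_act_closed T V wV)
      finally show ?thesis using c by (simp add: field_simps)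
    qed
    then show "\<exists>\<epsilon>>0. \<forall>w\<in>V \<times> V. \<epsilon> * (N (fst w) + N (snd w)) \<le>
      N (fst (cpoly_act T [:- l, 1:] w)) + N (snd (cpoly_act T [:- l, 1:] w))"
      using e(1) c unfolding M_def by (intro exI[of _ "e / c"]) auto
  qed (simp_all add: assms)
  then show False by (rule operator_without_eigenvalues.contradiction)
qed

section \<open>The Frobenius theorem\<close>

lemma scaleR_double:
  fixes v :: "'a::real_vector"
  shows "(2 * r) *\<^sub>R v = r *\<^sub>R v + r *\<^sub>R v" "(r * 2) *\<^sub>R v = r *\<^sub>R v + r *\<^sub>R v"
  by (simp_all only: mult_2 mult_2_right scaleR_left_distrib)

lemma no_zero_divisors_from_joint:
  assumes "\<And>a::'a::real_algebra. joint_zero_divisor a \<Longrightarrow> a = 0" "a * b = 0" "b * a = (0::'a)"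
  shows "a = 0 \<or> b = 0"
  using assms unfolding joint_zero_divisor_def by metis

text \<open>Peirce decomposition: ex(1-e) and (1-e)xe have square zero, and (1-e)x(1-e) is
  annihilated by e on both sides. All three vanish, which leaves x = exe.\<close>

lemma idempotent_is_unit:
  fixes e :: "'a::real_algebra"
  assumes nzd: "\<And>a b::'a. a * b = 0 \<Longrightarrow> b * a = 0 \<Longrightarrow> a = 0 \<or> b = 0"
    and e: "e * e = e" "e \<noteq> 0"
  shows "is_unit_element e"
proof -
  have e': "e * (e * x) = e * x" for x
    by (simp add: e(1) mult.assoc[symmetric])
  have "e * x = x \<and> x * e = x" for x
  proof -
    define y where "y = e * x - e * x * e"
    have "y * e = 0" "e * y = y"
      by (simp_all add: y_def algebra_simps e e' mult.assoc)
    then have "y * y = 0"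
      by (metis mult.assoc mult_zero_left)
    then have y: "y = 0" using nzd by blast
    define w where "w = x * e - e * x * e"
    have "e * w = 0" "w * e = w"
      by (simp_all add: w_def algebra_simps e e' mult.assoc)
    then have "w * w = 0"
      by (metis mult.assoc mult_zero_right)
    then have w: "w = 0" using nzd by blast
    define z where "z = x - e * x - x * e + e * x * e"
    have "e * z = 0" "z * e = 0"
      by (simp_all add: z_def algebra_simps e e' mult.assoc)
    then have z: "z = 0" using nzd e(2) by blast
    define r where "r = e * x * e"
    have "e * x = r" "x * e = r" "x - e * x - x * e + r = 0"
      using y w z unfolding y_def w_def z_def r_def[symmetric] by simp_all
    then show ?thesis by simp
  qed
  then show ?thesis by (simp add: is_unit_element_def)
qed

lemma unit_from_cubic:
  fixes a :: "'a::real_algebra"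
  assumes nzd: "\<And>a b::'a. a * b = 0 \<Longrightarrow> b * a = 0 \<Longrightarrow> a = 0 \<or> b = 0"
    and a: "a \<noteq> 0" and cubic: "a * (a * a) = (2 * \<alpha>) *\<^sub>R (a * a) - (\<alpha>\<^sup>2 + \<beta>\<^sup>2) *\<^sub>R a"
  shows "\<exists>e::'a. is_unit_element e \<and> e \<noteq> 0"
proof -
  define r where "r = \<alpha>\<^sup>2 + \<beta>\<^sup>2"
  have "r \<noteq> 0"
  proof
    assume "r = 0"
    then have "\<alpha> = 0" "\<beta> = 0" by (auto simp: r_def sum_power2_eq_zero_iff)
    then have "a * (a * a) = 0" using cubic by simp
    then have "a * a = 0" using nzd[of a "a * a"] a by (auto simp: mult.assoc)
    then show False using nzd a by blast
  qed
  \<comment> \<open>The cubic relation reads r a = (2\<alpha> a - a^2) a, so this e fixes a from the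
    left. Being a polynomial in a without constant term, e then fixes itself.\<close>
  define e where "e = (1 / r) *\<^sub>R ((2 * \<alpha>) *\<^sub>R a - a * a)"
  have ea: "e * a = a"
  proof -
    have "e * a = (1 / r) *\<^sub>R ((2 * \<alpha>) *\<^sub>R (a * a) - a * (a * a))"
      by (simp add: e_def left_diff_distrib mult.assoc)
    then show ?thesis
      unfolding cubic r_def[symmetric] using \<open>r \<noteq> 0\<close> by simp
  qed
  have "e * e = e"
  proof -
    have "e * ((1 / r) *\<^sub>R ((2 * \<alpha>) *\<^sub>R a - a * a)) = (1 / r) *\<^sub>R ((2 * \<alpha>) *\<^sub>R (e * a) - (e * a) * a)"
      by (simp add: right_diff_distrib mult.assoc)
    then show ?thesis unfolding ea e_def[symmetric] .
  qed
  moreover have "e \<noteq> 0" using ea a by auto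
  ultimately show ?thesis using idempotent_is_unit nzd by blast
qed

definition algebra_isomorphism :: "('b::real_algebra \<Rightarrow> 'a::real_algebra) \<Rightarrow> bool" where
  "algebra_isomorphism g \<longleftrightarrow> linear g \<and> bij g \<and> (\<forall>x y. g (x * y) = g x * g y)"

text \<open>The algebra has no suitable norm yet: the norm of the model is transported along the
  isomorphism, which is then isometric by construction.\<close>

lemma isometric_isomorphism_inv:
  fixes g :: "'b::{real_algebra, real_normed_vector} \<Rightarrow> 'a::real_algebra"
  assumes "algebra_isomorphism g"
  shows "isometric_isomorphism (\<lambda>x. norm (inv g x)) (inv g)"
proof -
  have g: "linear g" "bij g" "\<And>x y. g (x * y) = g x * g y"
    using assms by (auto simp: algebra_isomorphism_def)
  have gi: "g (inv g x) = x" "inv g (g y) = y" for x y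
    using g(2) by (simp_all add: bij_is_surj surj_f_inv_f bij_is_inj)
  have "linear (inv g)"
  proof (rule linearI)
    show "inv g (x + y) = inv g x + inv g y" for x y
      by (metis gi linear_add[OF g(1)])
    show "inv g (c *\<^sub>R x) = c *\<^sub>R inv g x" for c x
      by (metis gi linear_cmul[OF g(1)])
  qed
  moreover have "inv g (x * y) = inv g x * inv g y" for x y
    by (metis gi g(3))
  ultimately show ?thesis
    using g(2) by (simp add: isometric_isomorphism_def bij_imp_bij_inv)
qed

locale quadratic_division =
  fixes e :: "'a::real_algebra"
  assumes unit: "e * x = x" "x * e = x" and e_nonzero: "e \<noteq> 0"
    and nzd: "a * b = 0 \<Longrightarrow> b * a = 0 \<Longrightarrow> a = 0 \<or> b = (0::'a)"
    and quadratic: "\<exists>\<alpha> \<beta>. (a - \<alpha> *\<^sub>R e) * (a - \<alpha> *\<^sub>R e) = (- (\<beta>\<^sup>2)) *\<^sub>R e"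
begin

text \<open>The purely imaginary elements of the classical proof. With the multiples of e they span
  the algebra (\<open>decompose\<close>); the substance is closure under addition.\<close>

definition imaginary :: "'a set" where
  "imaginary = {x. \<exists>\<beta>. x * x = (- (\<beta>\<^sup>2)) *\<^sub>R e}"

lemma imaginaryI: "x * x = r *\<^sub>R e \<Longrightarrow> r \<le> 0 \<Longrightarrow> x \<in> imaginary"
  unfolding imaginary_def by (auto intro!: exI[of _ "sqrt (- r)"])

lemma scaleR_e_eq_iff: "r *\<^sub>R e = s *\<^sub>R e \<longleftrightarrow> r = s"
  using e_nonzero by simp

lemma imaginary_scaleR: "x \<in> imaginary \<Longrightarrow> c *\<^sub>R x \<in> imaginary"
proof -
  assume "x \<in> imaginary"
  then obtain b where "x * x = (- (b\<^sup>2)) *\<^sub>R e" by (auto simp: imaginary_def)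
  then have "(c *\<^sub>R x) * (c *\<^sub>R x) = (- ((c * b)\<^sup>2)) *\<^sub>R e"
    by (simp add: power2_eq_square algebra_simps)
  then show ?thesis unfolding imaginary_def by blast
qed

lemma imaginary_unit_multiple: "r *\<^sub>R e \<in> imaginary \<Longrightarrow> r = 0"
proof -
  assume "r *\<^sub>R e \<in> imaginary"
  then obtain b where "(r * r) *\<^sub>R e = (- (b\<^sup>2)) *\<^sub>R e" by (auto simp: imaginary_def unit)
  then have "r\<^sup>2 + b\<^sup>2 = 0" unfolding scaleR_e_eq_iff by (simp add: power2_eq_square)
  then show ?thesis by (simp add: sum_power2_eq_zero_iff)
qed

text \<open>Write y = s'x + c'e. If c' were nonzero, comparing y^2 with x^2 would make s'x a
  multiple of e, hence 0, and y = c'e would be imaginary, which is impossible. So c' = 0 and x + y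
  is a multiple of x.\<close>

lemma imaginary_dependent:
  assumes x: "x \<in> imaginary" and y: "y \<in> imaginary" and t: "t \<noteq> 0"
    and dep: "s *\<^sub>R x + t *\<^sub>R y = c *\<^sub>R e"
  shows "x + y \<in> imaginary"
proof -
  define s' c' where "s' = - s / t" and "c' = c / t"
  have "t *\<^sub>R y = c *\<^sub>R e - s *\<^sub>R x" using dep by (simp add: algebra_simps)
  then have "(1 / t) *\<^sub>R (t *\<^sub>R y) = (1 / t) *\<^sub>R (c *\<^sub>R e - s *\<^sub>R x)" by simp
  then have y': "y = s' *\<^sub>R x + c' *\<^sub>R e" using t by (simp add: s'_def c'_def algebra_simps)
  have "c' = 0"
  proof (rule ccontr)
    assume c': "c' \<noteq> 0"
    obtain p where p: "x * x = (- (p\<^sup>2)) *\<^sub>R e" using x by (auto simp: imaginary_def)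
    obtain q where q: "y * y = (- (q\<^sup>2)) *\<^sub>R e" using y by (auto simp: imaginary_def)
    have "y * y = (s' * s') *\<^sub>R (x * x) + (2 * s' * c') *\<^sub>R x + (c' * c') *\<^sub>R e"
    proof -
      have "(2 * s' * c') *\<^sub>R x = (s' * c') *\<^sub>R x + (s' * c') *\<^sub>R x"
        by (simp only: mult.assoc scaleR_double)
      then show ?thesis by (simp add: y' algebra_simps unit)
    qed
    then have "(2 * s' * c') *\<^sub>R x = (s' * s' * p\<^sup>2 - q\<^sup>2 - c' * c') *\<^sub>R e" (is "_ = ?k *\<^sub>R e")
      unfolding p q by (simp add: algebra_simps)
    moreover have "s' \<noteq> 0"
    proof
      assume "s' = 0"
      then have "c' *\<^sub>R e \<in> imaginary" using y y' by simp
      then show False using imaginary_unit_multiple c' by blast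
    qed
    ultimately obtain m k where m: "m \<noteq> 0" "m *\<^sub>R x = k *\<^sub>R e"
      using c' by (metis mult_eq_0_iff zero_neq_numeral)
    have "(1 / m) *\<^sub>R (m *\<^sub>R x) = (1 / m) *\<^sub>R (k *\<^sub>R e)" by (simp only: m(2))
    then have xe: "x = (k / m) *\<^sub>R e" using m(1) by simp
    then have "k / m = 0" using x imaginary_unit_multiple by metis
    then have "x = 0" using xe by simp
    then have "c' *\<^sub>R e \<in> imaginary" using y y' by simp
    then show False using imaginary_unit_multiple c' by blast
  qed
  then have "x + y = (1 + s') *\<^sub>R x" by (simp add: y' algebra_simps)
  then show ?thesis using imaginary_scaleR[OF x] by simp
qed

text \<open>In the sum of the quadratic relations of x + y and x - y the products xy and yx cancel,
  which leaves a linear relation between x, y and e. Its coefficients \<alpha> + \<gamma> and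
  \<alpha> - \<gamma> both vanish only if \<alpha> = 0, and then x + y is imaginary by its own
  relation.\<close>

lemma imaginary_add:
  assumes x: "x \<in> imaginary" and y: "y \<in> imaginary"
  shows "x + y \<in> imaginary"
proof -
  obtain p where p: "x * x = (- (p\<^sup>2)) *\<^sub>R e" using x by (auto simp: imaginary_def)
  obtain q where q: "y * y = (- (q\<^sup>2)) *\<^sub>R e" using y by (auto simp: imaginary_def)
  obtain \<alpha> \<beta> where ab: "(x + y - \<alpha> *\<^sub>R e) * (x + y - \<alpha> *\<^sub>R e) = (- (\<beta>\<^sup>2)) *\<^sub>R e"
    using quadratic by blast
  obtain \<gamma> \<delta> where cd: "(x - y - \<gamma> *\<^sub>R e) * (x - y - \<gamma> *\<^sub>R e) = (- (\<delta>\<^sup>2)) *\<^sub>R e"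
    using quadratic by blast
  have "(x + y - \<alpha> *\<^sub>R e) * (x + y - \<alpha> *\<^sub>R e) + (x - y - \<gamma> *\<^sub>R e) * (x - y - \<gamma> *\<^sub>R e) =
     2 *\<^sub>R (x * x) + 2 *\<^sub>R (y * y) - 2 *\<^sub>R ((\<alpha> + \<gamma>) *\<^sub>R x + (\<alpha> - \<gamma>) *\<^sub>R y) + (\<alpha>\<^sup>2 + \<gamma>\<^sup>2) *\<^sub>R e"
    by (simp add: algebra_simps unit scaleR_2 scaleR_double power2_eq_square)
  then have lin: "(- (\<beta>\<^sup>2)) *\<^sub>R e + (- (\<delta>\<^sup>2)) *\<^sub>R e = 2 *\<^sub>R ((- (p\<^sup>2)) *\<^sub>R e) + 2 *\<^sub>R ((- (q\<^sup>2)) *\<^sub>R e)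
      - 2 *\<^sub>R ((\<alpha> + \<gamma>) *\<^sub>R x + (\<alpha> - \<gamma>) *\<^sub>R y) + (\<alpha>\<^sup>2 + \<gamma>\<^sup>2) *\<^sub>R e" (is "?l = _ - 2 *\<^sub>R ?u + _")
    unfolding ab cd p q .
  define k where "k = \<alpha>\<^sup>2 + \<gamma>\<^sup>2 - 2 * p\<^sup>2 - 2 * q\<^sup>2 + \<beta>\<^sup>2 + \<delta>\<^sup>2"
  have "2 *\<^sub>R ?u = 2 *\<^sub>R ((- (p\<^sup>2)) *\<^sub>R e) + 2 *\<^sub>R ((- (q\<^sup>2)) *\<^sub>R e) + (\<alpha>\<^sup>2 + \<gamma>\<^sup>2) *\<^sub>R e - ?l"
    unfolding lin by simp
  also have "\<dots> = k *\<^sub>R e"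
    by (simp add: k_def scaleR_left_distrib scaleR_left_diff_distrib)
  finally have "(1/2) *\<^sub>R (2 *\<^sub>R ?u) = (1/2) *\<^sub>R (k *\<^sub>R e)" by (simp only:)
  then have dep: "?u = (k / 2) *\<^sub>R e" by simp
  consider "\<alpha> = 0" | "\<alpha> - \<gamma> \<noteq> 0" | "\<alpha> + \<gamma> \<noteq> 0" by linarith
  then show ?thesis
  proof cases
    case 1
    then show ?thesis using ab by (auto simp: imaginary_def)
  next
    case 2
    show ?thesis by (rule imaginary_dependent[OF x y 2 dep])
  next
    case 3
    have "y + x \<in> imaginary"
      by (rule imaginary_dependent[OF y x 3]) (use dep in \<open>simp add: add.commute\<close>)
    then show ?thesis by (simp add: add.commute)
  qed
qed

text \<open>Polarization of the square; in the quaternions c is minus the inner product of x and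
  y.\<close>

lemma imaginary_anticommutator:
  assumes x: "x \<in> imaginary" and y: "y \<in> imaginary"
  obtains c where "x * y + y * x = (2 * c) *\<^sub>R e"
proof -
  obtain p where p: "x * x = (- (p\<^sup>2)) *\<^sub>R e" using x by (auto simp: imaginary_def)
  obtain q where q: "y * y = (- (q\<^sup>2)) *\<^sub>R e" using y by (auto simp: imaginary_def)
  obtain r where r: "(x + y) * (x + y) = (- (r\<^sup>2)) *\<^sub>R e"
    using imaginary_add[OF x y] by (auto simp: imaginary_def)
  have "x * y + y * x = (x + y) * (x + y) - x * x - y * y" by (simp add: algebra_simps)
  also have "\<dots> = (p\<^sup>2 + q\<^sup>2 - r\<^sup>2) *\<^sub>R e"
    unfolding p q r by (simp add: algebra_simps)
  finally show ?thesis using that[of "(p\<^sup>2 + q\<^sup>2 - r\<^sup>2) / 2"] by simp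
qed

lemma imaginary_normalize:
  assumes x: "x \<in> imaginary" "x \<noteq> 0"
  obtains t where "t \<noteq> 0" "(t *\<^sub>R x) * (t *\<^sub>R x) = - e"
proof -
  obtain p where p: "x * x = (- (p\<^sup>2)) *\<^sub>R e" using x by (auto simp: imaginary_def)
  have "p \<noteq> 0"
  proof
    assume "p = 0"
    then have "x * x = 0" using p by simp
    then show False using nzd x(2) by blast
  qed
  then show ?thesis
    using that[of "1 / p"] by (simp add: p power2_eq_square)
qed

lemma decompose: "\<exists>\<alpha>. \<exists>u\<in>imaginary. a = \<alpha> *\<^sub>R e + u"
proof -
  obtain \<alpha> \<beta> where "(a - \<alpha> *\<^sub>R e) * (a - \<alpha> *\<^sub>R e) = (- (\<beta>\<^sup>2)) *\<^sub>R e"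
    using quadratic by blast
  then have "a - \<alpha> *\<^sub>R e \<in> imaginary" by (auto simp: imaginary_def)
  then show ?thesis by (intro exI[of _ \<alpha>] bexI[of _ "a - \<alpha> *\<^sub>R e"]) auto
qed

lemma frobenius_real:
  assumes "imaginary \<subseteq> {0}"
  shows "algebra_isomorphism (\<lambda>r::real. r *\<^sub>R e)"
proof -
  have "bij (\<lambda>r::real. r *\<^sub>R e)"
  proof (rule bijI)
    show "inj (\<lambda>r::real. r *\<^sub>R e)" using e_nonzero by (auto simp: inj_def)
    show "surj (\<lambda>r::real. r *\<^sub>R e)"
      using decompose assms by (fastforce simp: surj_def)
  qed
  moreover have "linear (\<lambda>r::real. r *\<^sub>R e)"
    by (rule linearI) (simp_all add: scaleR_left_distrib)
  ultimately show ?thesis by (simp add: algebra_isomorphism_def unit)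
qed

lemma frobenius_complex:
  assumes i: "i * i = - e" and I: "\<And>x. x \<in> imaginary \<Longrightarrow> \<exists>t. x = t *\<^sub>R i"
  shows "algebra_isomorphism (\<lambda>z. Re z *\<^sub>R e + Im z *\<^sub>R i)" (is "algebra_isomorphism ?g")
proof -
  have lin: "linear ?g"
    by (rule linearI) (simp_all add: algebra_simps)
  have mult: "?g (x * y) = ?g x * ?g y" for x y
    by (simp add: algebra_simps unit i)
  have "inj ?g"
  proof (subst linear_injective_0[OF lin], intro allI impI)
    fix z assume "?g z = 0"
    \<comment> \<open>Multiplying by the conjugate reduces injectivity to positivity of the norm; q'
      does the same for the quaternions below.\<close>
    then have "?g (cnj z * z) = 0" by (simp only: mult mult_zero_right)
    then have "((cmod z)\<^sup>2) *\<^sub>R e = 0" by (simp add: cmod_power2 power2_eq_square complex_eq_iff)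
    then show "z = 0" using e_nonzero by simp
  qed
  moreover have "surj ?g"
  proof -
    have "\<exists>z. a = ?g z" for a
    proof -
      obtain r u where "u \<in> imaginary" "a = r *\<^sub>R e + u" using decompose by blast
      then obtain t where "a = r *\<^sub>R e + t *\<^sub>R i" using I by blast
      then show ?thesis by (intro exI[of _ "Complex r t"]) simp
    qed
    then show ?thesis by (auto simp: surj_def)
  qed
  ultimately show ?thesis using lin mult by (simp add: algebra_isomorphism_def bij_def)
qed

lemma frobenius_quaternion:
  assumes i: "i * i = - e" and j: "j * j = - e" and ij: "j * i = - (i * j)"
  shows "algebra_isomorphism (\<lambda>q. Re4 q *\<^sub>R e + Im4 q *\<^sub>R i + Jm4 q *\<^sub>R j + Km4 q *\<^sub>R (i * j))"
    (is "algebra_isomorphism ?g")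
proof -
  define k where "k = i * j"
  have i': "i * (i * x) = - x" and j': "j * (j * x) = - x" and ij': "j * (i * x) = - (i * (j * x))" for x
    using i j ij by (simp_all add: mult.assoc[symmetric] unit)
  have prods: "i * j = k" "j * i = - k" "i * k = - j" "k * i = j" "j * k = i" "k * j = - i" "k * k = - e"
    by (simp_all add: k_def mult.assoc i j ij i' j' ij' unit)
  have lin: "linear ?g"
    by (rule linearI) (simp_all add: algebra_simps quat_ops)
  have mult: "?g (x * y) = ?g x * ?g y" for x y
    unfolding prods by (simp add: algebra_simps unit i j prods quat_ops)
  have "inj ?g"
  proof (subst linear_injective_0[OF lin], intro allI impI)
    fix q assume "?g q = 0"
    define q' where "q' = Quat (Re4 q) (- Im4 q) (- Jm4 q) (- Km4 q)"
    have "?g (q' * q) = 0" using \<open>?g q = 0\<close> by (simp only: mult mult_zero_right)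
    moreover have "?g (q' * q) = (q \<bullet> q) *\<^sub>R e"
      by (simp add: q'_def quat_ops inner_quat_def)
    ultimately show "q = 0" using e_nonzero by simp
  qed
  moreover have "surj ?g"
  proof -
    have "\<exists>q. a = ?g q" for a
    proof -
      obtain r u where u: "u \<in> imaginary" "a = r *\<^sub>R e + u" using decompose by blast
      have im: "i \<in> imaginary" "j \<in> imaginary" "k \<in> imaginary"
        by (rule imaginaryI[of _ "-1"]; simp add: i j prods)+
      obtain x where x: "u * i + i * u = (2 * x) *\<^sub>R e" using imaginary_anticommutator[OF u(1) im(1)] .
      obtain y where y: "u * j + j * u = (2 * y) *\<^sub>R e" using imaginary_anticommutator[OF u(1) im(2)] .
      obtain z where z: "u * k + k * u = (2 * z) *\<^sub>R e" using imaginary_anticommutator[OF u(1) im(3)] .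
      \<comment> \<open>Removes from u its components along i, j and k (plus signs because i^2 = j^2
        = k^2 = -e), so that v anticommutes with all three.\<close>
      define v where "v = u + x *\<^sub>R i + y *\<^sub>R j + z *\<^sub>R k"
      have "v * i + i * v = (u * i + i * u) - (2 * x) *\<^sub>R e"
        by (simp add: v_def algebra_simps i j prods scaleR_double)
      then have vi: "v * i = - (i * v)" using x by (simp add: eq_neg_iff_add_eq_0)
      have "v * j + j * v = (u * j + j * u) - (2 * y) *\<^sub>R e"
        by (simp add: v_def algebra_simps i j prods scaleR_double)
      then have vj: "v * j = - (j * v)" using y by (simp add: eq_neg_iff_add_eq_0)
      have "v * k + k * v = (u * k + k * u) - (2 * z) *\<^sub>R e"
        by (simp add: v_def algebra_simps i j prods scaleR_double)
      then have vk: "v * k = - (k * v)" using z by (simp add: eq_neg_iff_add_eq_0)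
      \<comment> \<open>Anticommuting with i and with j means commuting with k = ij. Together with
        \<open>vk\<close> this annihilates both kv and vk.\<close>
      have "v * k = (v * i) * j" by (simp add: k_def mult.assoc)
      also have "\<dots> = - (i * (v * j))" by (simp add: vi mult.assoc)
      also have "\<dots> = k * v" by (simp add: vj k_def mult.assoc)
      finally have "k * v = - (k * v)" using vk by simp
      then have "2 *\<^sub>R (k * v) = 0" by (simp add: scaleR_2 eq_neg_iff_add_eq_0)
      then have "k * v = 0" by simp
      moreover have "v * k = 0" using vk \<open>k * v = 0\<close> by simp
      moreover have "k \<noteq> 0" using prods(7) e_nonzero by auto
      ultimately have "v = 0" using nzd by blast
      moreover have "u = v - (x *\<^sub>R i + y *\<^sub>R j + z *\<^sub>R k)"
        by (simp add: v_def)
      ultimately have "u = - (x *\<^sub>R i + y *\<^sub>R j + z *\<^sub>R k)" by simp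
      then show ?thesis
        using u(2) by (intro exI[of _ "Quat r (- x) (- y) (- z)"]) (simp add: k_def)
    qed
    then show ?thesis by (auto simp: surj_def)
  qed
  ultimately show ?thesis using lin mult by (simp add: algebra_isomorphism_def bij_def)
qed

theorem frobenius: "\<exists>N::'a \<Rightarrow> real. isometric_to_RCH N"
proof (cases "imaginary \<subseteq> {0}")
  case True
  then show ?thesis
    using isometric_isomorphism_inv[OF frobenius_real] unfolding isometric_to_RCH_def by blast
next
  case False
  then obtain x where x: "x \<in> imaginary" "x \<noteq> 0" by auto
  then obtain s where s: "s \<noteq> 0" "(s *\<^sub>R x) * (s *\<^sub>R x) = - e" using imaginary_normalize by metis
  define i where "i = s *\<^sub>R x"
  have i: "i * i = - e" "i \<in> imaginary" using s imaginary_scaleR[OF x(1)] by (auto simp: i_def)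
  show ?thesis
  proof (cases "\<forall>y\<in>imaginary. \<exists>t. y = t *\<^sub>R i")
    case True
    then show ?thesis
      using isometric_isomorphism_inv[OF frobenius_complex[OF i(1)]] unfolding isometric_to_RCH_def by blast
  next
    case False
    then obtain y where y: "y \<in> imaginary" "\<And>t. y \<noteq> t *\<^sub>R i" by blast
    obtain c where c: "y * i + i * y = (2 * c) *\<^sub>R e" using imaginary_anticommutator[OF y(1) i(2)] .
    \<comment> \<open>A Gram-Schmidt step: v is the part of y that anticommutes with i, and it is
      nonzero because y is not a multiple of i.\<close>
    define v where "v = y + c *\<^sub>R i"
    have "v * i + i * v = (y * i + i * y) - (2 * c) *\<^sub>R e"
      by (simp add: v_def algebra_simps i scaleR_double)
    then have vi: "v * i = - (i * v)" using c by (simp add: eq_neg_iff_add_eq_0)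
    have "v \<noteq> 0" using y(2)[of "- c"] by (auto simp: v_def eq_neg_iff_add_eq_0)
    moreover have "v \<in> imaginary"
      unfolding v_def by (intro imaginary_add imaginary_scaleR y i)
    ultimately obtain t where t: "t \<noteq> 0" "(t *\<^sub>R v) * (t *\<^sub>R v) = - e" using imaginary_normalize by metis
    have "(t *\<^sub>R v) * i = - (i * (t *\<^sub>R v))" using vi by simp
    from frobenius_quaternion[OF i(1) t(2) this] show ?thesis
      using isometric_isomorphism_inv unfolding isometric_to_RCH_def by blast
  qed
qed

end

text \<open>Once a unit exists, the cubic relation says a q(a) = q(a) a = 0 for a real quadratic q,
  so q(a) = 0 unless a = 0. Completing the square gives the relation required by
  \<open>quadratic_division\<close>.\<close>

lemma isometric_to_RCH_from_cubic:
  assumes nonzero: "\<exists>x::'a::real_algebra. x \<noteq> 0"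
    and jzd: "\<And>a::'a. joint_zero_divisor a \<Longrightarrow> a = 0"
    and cubic: "\<And>a::'a. \<exists>\<alpha> \<beta>. a * (a * a) = (2 * \<alpha>) *\<^sub>R (a * a) - (\<alpha>\<^sup>2 + \<beta>\<^sup>2) *\<^sub>R a"
  shows "\<exists>N::'a \<Rightarrow> real. isometric_to_RCH N"
proof -
  have nzd: "a * b = 0 \<Longrightarrow> b * a = 0 \<Longrightarrow> a = 0 \<or> b = 0" for a b :: 'a
    using no_zero_divisors_from_joint[OF jzd] by blast
  obtain e :: 'a where e: "is_unit_element e" "e \<noteq> 0"
    using unit_from_cubic[OF nzd] nonzero cubic by metis
  interpret quadratic_division e
  proof
    show "e * x = x" "x * e = x" for x using e(1) by (auto simp: is_unit_element_def)
    note u = this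
    show "e \<noteq> 0" by fact
    show "a * b = 0 \<Longrightarrow> b * a = 0 \<Longrightarrow> a = 0 \<or> b = 0" for a b :: 'a by (rule nzd)
    fix a :: 'a
    obtain \<alpha> \<beta> where ab: "a * (a * a) = (2 * \<alpha>) *\<^sub>R (a * a) - (\<alpha>\<^sup>2 + \<beta>\<^sup>2) *\<^sub>R a"
      using cubic by blast
    define q where "q = a * a - (2 * \<alpha>) *\<^sub>R a + (\<alpha>\<^sup>2 + \<beta>\<^sup>2) *\<^sub>R e"
    have "a * q = 0" "q * a = 0" using ab by (simp_all add: q_def algebra_simps u mult.assoc)
    then consider "a = 0" | "q = 0" using nzd by blast
    then show "\<exists>\<alpha> \<beta>. (a - \<alpha> *\<^sub>R e) * (a - \<alpha> *\<^sub>R e) = (- (\<beta>\<^sup>2)) *\<^sub>R e"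
    proof cases
      case 1
      then show ?thesis by (intro exI[of _ 0]) simp
    next
      case 2
      have "(a - \<alpha> *\<^sub>R e) * (a - \<alpha> *\<^sub>R e) = q - (\<beta>\<^sup>2) *\<^sub>R e"
        by (simp add: q_def algebra_simps u power2_eq_square scaleR_double)
      then show ?thesis using 2 by (intro exI[of _ \<alpha>] exI[of _ \<beta>]) simp
    qed
  qed
  show ?thesis by (rule frobenius)
qed

section \<open>Natural norms\<close>

lemma apow_1 [simp]: "apow x (Suc 0) = x"
  by (simp add: apow_def)

lemma apow_Suc: "1 \<le> n \<Longrightarrow> apow x (Suc n) = x * apow x n"
  by (cases n) (simp_all add: apow_def)

lemma apow_2: "apow x 2 = x * x"
  using apow_Suc[of 1 x] by (simp add: numeral_2_eq_2)

lemma apow_add: "1 \<le> m \<Longrightarrow> 1 \<le> n \<Longrightarrow> apow x (m + n) = apow x m * apow x n"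
proof (induction m rule: nat_induct_at_least)
  case base
  then show ?case by (simp add: apow_Suc)
next
  case (Suc m)
  then show ?case by (simp add: apow_Suc mult.assoc)
qed

lemma apow_mult:
  assumes "1 \<le> m"
  shows "1 \<le> n \<Longrightarrow> apow (apow x m) n = apow x (m * n)"
proof (induction n rule: nat_induct_at_least)
  case base
  then show ?case by simp
next
  case (Suc n)
  then have "apow (apow x m) (Suc n) = apow x m * apow x (m * n)" by (simp add: apow_Suc)
  also have "\<dots> = apow x (m * Suc n)" using Suc assms by (subst apow_add[symmetric]) auto
  finally show ?case .
qed

text \<open>A constant factor disappears in roots of order k^m: for a > b the powers (a/b)^(k^m)
  could not stay below C.\<close>

lemma le_of_power_le_const:
  fixes a b :: real
  assumes "0 \<le> a" "0 \<le> b" "1 < k" and le: "\<And>m. a ^ (k ^ m) \<le> C * b ^ (k ^ m)"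
  shows "a \<le> b"
proof (rule ccontr)
  assume "\<not> a \<le> b"
  then have ab: "b < a" by simp
  show False
  proof (cases "b = 0")
    case True
    then show False using le[of 0] ab by simp
  next
    case False
    define q where "q = a / b"
    have q: "1 < q" "\<And>m. q ^ (k ^ m) \<le> C"
      using False ab le assms(2) by (auto simp: q_def power_divide field_simps)
    obtain n where n: "C < q ^ n" using real_arch_pow[OF q(1)] by blast
    have "n \<le> k ^ n" using \<open>1 < k\<close> by (simp add: less_imp_le_nat less_exp power_gt_expt)
    then have "q ^ n \<le> q ^ (k ^ n)" using q(1) by (simp add: power_increasing)
    then show False using q(2)[of n] n by simp
  qed
qed

lemma vs_norm_le_on_line:
  assumes "vs_norm N" "vs_norm n"
  shows "\<exists>M. \<forall>y\<in>span {p}. N y \<le> M * n y"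
proof (intro exI ballI)
  fix y assume "y \<in> span {p}"
  then obtain k where y: "y = k *\<^sub>R p" by (auto simp: span_singleton)
  show "N y \<le> (N p / n p) * n y"
    using vs_normD(2)[OF assms(2), of p] vs_normD(5)[OF assms(1)]
    by (cases "p = 0") (auto simp: y vs_normD(4)[OF assms(1)] vs_normD(4)[OF assms(2)])
qed

text \<open>The vector space carries no topology of its own, so the plane is parametrized by the
  complex numbers, whose unit circle is compact; the minimum of n over that circle gives the
  constant. Degenerate spans are lines.\<close>

lemma vs_norm_le_on_span2:
  assumes N: "vs_norm N" and n: "vs_norm n"
  shows "\<exists>M. \<forall>y\<in>span {p, q}. N y \<le> M * n y"
proof -
  consider "q \<in> span {p}" | "p = 0" | "q \<notin> span {p}" "p \<noteq> 0" by blast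
  then show ?thesis
  proof cases
    case 1
    then have "span {p, q} = span {p}" by (metis insert_commute span_redundant)
    then show ?thesis using vs_norm_le_on_line[OF assms] by metis
  next
    case 2
    then have "span {p, q} = span {q}" by simp
    then show ?thesis using vs_norm_le_on_line[OF assms] by metis
  next
    case 3
    define g where "g z = Re z *\<^sub>R p + Im z *\<^sub>R q" for z
    have g_diff: "g (z - w) = g z - g w" for z w by (simp add: g_def algebra_simps)
    have upper: "h (g z) \<le> (h p + h q) * cmod z" if h: "vs_norm h" for h z
    proof -
      have "h (g z) \<le> \<bar>Re z\<bar> * h p + \<bar>Im z\<bar> * h q"
        unfolding g_def vs_normD(4)[OF h, symmetric] by (rule vs_normD(3)[OF h])
      also have "\<dots> \<le> cmod z * h p + cmod z * h q"
        by (intro add_mono mult_right_mono abs_Re_le_cmod abs_Im_le_cmod vs_normD(1)[OF h])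
      finally show ?thesis by (simp add: algebra_simps)
    qed
    have g_eq_0: "z = 0" if "g z = 0" for z
    proof -
      have "Im z = 0"
      proof (rule ccontr)
        assume i: "Im z \<noteq> 0"
        have "Im z *\<^sub>R q = - (Re z *\<^sub>R p)" using that by (simp add: g_def eq_neg_iff_add_eq_0 add.commute)
        then have "Im z *\<^sub>R q \<in> span {p}"
          by (metis span_base span_scale span_neg insertI1)
        then have "(1 / Im z) *\<^sub>R (Im z *\<^sub>R q) \<in> span {p}" by (rule span_scale)
        then show False using i 3(1) by simp
      qed
      then show ?thesis using that 3(2) by (simp add: g_def complex_eq_iff)
    qed
    have "continuous_on (sphere 0 1) (\<lambda>z. n (g z))"
    proof (rule lipschitz_on_continuous_on[of "n p + n q"], rule lipschitz_onI)
      fix z w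
      have "n (g z) \<le> n (g w) + n (g (z - w))" "n (g w) \<le> n (g z) + n (g (z - w))"
        using vs_normD(3)[OF n, of "g w" "g (z - w)"] vs_normD(7)[OF n, of "g z" "g (z - w)"]
        by (simp_all add: g_diff)
      then show "dist (n (g z)) (n (g w)) \<le> (n p + n q) * dist z w"
        using upper[OF n, of "z - w"] by (simp add: dist_norm)
    qed (simp add: vs_normD(1)[OF n])
    then obtain z0 where z0: "cmod z0 = 1" "\<And>z. cmod z = 1 \<Longrightarrow> n (g z0) \<le> n (g z)"
      using continuous_attains_inf[of "sphere (0::complex) 1" "\<lambda>z. n (g z)"] by auto
    have "g z0 \<noteq> 0" using g_eq_0[of z0] z0(1) by auto
    then have m: "n (g z0) > 0" using vs_normD(1,2)[OF n, of "g z0"] by linarith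
    have lower: "n (g z0) * cmod z \<le> n (g z)" for z
    proof (cases "z = 0")
      case False
      have "g z = cmod z *\<^sub>R g (z / cmod z)" using False by (simp add: g_def scaleR_right_distrib)
      then have "n (g z) = cmod z * n (g (z / cmod z))" by (simp add: vs_normD(4)[OF n])
      moreover have "n (g z0) \<le> n (g (z / cmod z))" using False by (intro z0(2)) (simp add: norm_divide)
      ultimately show ?thesis using False by (simp add: mult.commute)
    qed (simp add: vs_normD(1)[OF n])
    show ?thesis
    proof (intro exI ballI)
      fix y assume "y \<in> span {p, q}"
      then obtain a b where y: "y = a *\<^sub>R p + b *\<^sub>R q"
        by (auto simp: span_insert span_singleton algebra_simps)
      then have "y = g (Complex a b)" by (simp add: g_def)
      then obtain z where z: "y = g z" by blast
      have "N y \<le> (N p + N q) * cmod z" unfolding z by (rule upper[OF N])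
      also have "\<dots> \<le> (N p + N q) * (n y / n (g z0))"
        using lower[of z] m vs_normD(1)[OF N]
        by (intro mult_left_mono) (auto simp: z field_simps)
      finally show "N y \<le> (N p + N q) / n (g z0) * n y" by simp
    qed
  qed
qed

text \<open>What the three models have in common. The last clause identifies the squared norm with
  the constant term of the quadratic equation of x, which ties the norm to the algebra
  structure.\<close>

locale RCH_normed =
  fixes n :: "'a::real_algebra \<Rightarrow> real" and e :: 'a and ip :: "'a \<Rightarrow> 'a \<Rightarrow> real"
  assumes unit: "e * x = x" "x * e = x" and e_nonzero: "e \<noteq> 0"
    and n: "vs_norm n" and ip: "inner_product ip" and n_ip: "n x = sqrt (ip x x)"
    and n_mult: "n (x * y) = n x * n y"
    and quadratic: "\<exists>\<alpha> \<beta>. (x - \<alpha> *\<^sub>R e) * (x - \<alpha> *\<^sub>R e) = (- (\<beta>\<^sup>2)) *\<^sub>R e \<and> (n x)\<^sup>2 = \<alpha>\<^sup>2 + \<beta>\<^sup>2"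
begin

lemma is_unit_e: "is_unit_element e"
  by (simp add: is_unit_element_def unit)

lemma unit_unique: "is_unit_element e' \<Longrightarrow> e' = e"
  by (metis is_unit_element_def unit(1))

lemma square_formula: "\<exists>\<alpha>. x * x = (2 * \<alpha>) *\<^sub>R x - ((n x)\<^sup>2) *\<^sub>R e"
proof -
  obtain \<alpha> \<beta> where ab: "(x - \<alpha> *\<^sub>R e) * (x - \<alpha> *\<^sub>R e) = (- (\<beta>\<^sup>2)) *\<^sub>R e" "(n x)\<^sup>2 = \<alpha>\<^sup>2 + \<beta>\<^sup>2"
    using quadratic by blast
  have "x * x = (x - \<alpha> *\<^sub>R e) * (x - \<alpha> *\<^sub>R e) + (2 * \<alpha>) *\<^sub>R x - (\<alpha>\<^sup>2) *\<^sub>R e"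
    by (simp add: algebra_simps unit scaleR_double power2_eq_square)
  then have "x * x = (2 * \<alpha>) *\<^sub>R x - ((n x)\<^sup>2) *\<^sub>R e"
    unfolding ab by (simp add: algebra_simps)
  then show ?thesis by blast
qed

lemma span_times:
  assumes "y \<in> span {e, x}" "z \<in> span {e, x}"
  shows "y * z \<in> span {e, x}" "y * z = z * y"
proof -
  obtain a b where y: "y = a *\<^sub>R e + b *\<^sub>R x" using assms(1) by (auto simp: span_insert span_singleton algebra_simps)
  obtain c d where z: "z = c *\<^sub>R e + d *\<^sub>R x" using assms(2) by (auto simp: span_insert span_singleton algebra_simps)
  obtain t where t: "x * x = (2 * t) *\<^sub>R x - ((n x)\<^sup>2) *\<^sub>R e" using square_formula by blast
  have in_span: "e \<in> span {e, x}" "x \<in> span {e, x}" by (auto intro: span_base)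
  then have "x * x \<in> span {e, x}" unfolding t by (intro span_diff span_scale)
  moreover have "y * z = (a * c) *\<^sub>R e + (a * d + b * c) *\<^sub>R x + (b * d) *\<^sub>R (x * x)"
    by (simp add: y z algebra_simps unit)
  ultimately show "y * z \<in> span {e, x}"
    using in_span by (simp add: span_add span_scale)
  show "y * z = z * y" by (simp add: y z algebra_simps unit)
qed

lemma subalgebra_generated: "real_subalgebra hull {e, x} = span {e, x}"
proof (rule hull_unique)
  show "{e, x} \<subseteq> span {e, x}" by (rule span_superset)
  show "real_subalgebra (span {e, x})"
    by (auto simp: real_subalgebra_def span_times)
  show "span {e, x} \<subseteq> T" if "{e, x} \<subseteq> T" "real_subalgebra T" for T
    using that by (intro span_minimal) (auto simp: real_subalgebra_def)
qed

lemma locally_complex: "locally_complex TYPE('a)"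
proof -
  have inv: "\<exists>z\<in>span {e, x}. y * z = e" if y: "y \<in> span {e, x}" "y \<noteq> 0" for x y
  proof -
    obtain t where t: "y * y = (2 * t) *\<^sub>R y - ((n y)\<^sup>2) *\<^sub>R e" using square_formula by blast
    \<comment> \<open>The conjugate of y over its squared norm: \<open>square_formula\<close> reads
      y (2t e - y) = n(y)^2 e.\<close>
    define z where "z = (1 / (n y)\<^sup>2) *\<^sub>R ((2 * t) *\<^sub>R e - y)"
    have "n y \<noteq> 0" using y(2) vs_normD(2)[OF n] by blast
    then have "y * z = e" by (simp add: z_def algebra_simps unit t)
    moreover have "z \<in> span {e, x}"
      unfolding z_def by (intro span_scale span_diff y) (auto intro: span_base)
    ultimately show ?thesis by blast
  qed
  have "is_field_extension e (span {e, x})" for x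
    unfolding is_field_extension_def real_subalgebra_def
    using span_times inv e_nonzero unit by (auto intro: span_base)
  moreover have "fin_dim (span {e, x})" for x
    unfolding fin_dim_def by (intro exI[of _ "{e, x}"]) auto
  moreover have "dim (span {e, x}) \<le> 2" for x
  proof -
    have "dim (span {e, x}) \<le> card {e, x}" by (rule dim_le_card) auto
    also have "\<dots> \<le> 2" by (simp add: card_insert_if)
    finally show ?thesis .
  qed
  ultimately show ?thesis
    unfolding locally_complex_def quadratic_algebra_def unital_algebra_def
    using is_unit_e unit_unique subalgebra_generated by metis
qed

lemma n_apow: "1 \<le> k \<Longrightarrow> n (apow x k) = n x ^ k"
  by (induction k rule: nat_induct_at_least) (simp_all add: apow_Suc n_mult)

lemma is_natural_norm: "is_natural_norm n"
  unfolding is_natural_norm_def using n ip n_ip n_apow by blast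

lemma apow_in_span: "1 \<le> k \<Longrightarrow> apow x k \<in> span {e, x}"
proof (induction k rule: nat_induct_at_least)
  case (Suc k)
  then show ?case using span_times(1)[of x x "apow x k"] by (simp add: apow_Suc span_base)
qed (simp add: span_base)

text \<open>Stated for a single x and for the exponents \<open>k ^ m\<close> only, because the
  C*-identity provides just the powers h^(2^m) of a self-adjoint h.\<close>

lemma norm_eq_from_powers:
  assumes N: "vs_norm N" and k: "1 < k" and pow: "\<And>m. N (apow x (k ^ m)) = N x ^ (k ^ m)"
  shows "N x = n x"
proof (rule antisym)
  have 1: "1 \<le> k ^ m" for m using k by simp
  obtain M where "\<And>y. y \<in> span {e, x} \<Longrightarrow> N y \<le> M * n y"
    using vs_norm_le_on_span2[OF N n] by blast
  then have "N x ^ (k ^ m) \<le> M * n x ^ (k ^ m)" for m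
    using apow_in_span[OF 1[of m], of x] unfolding pow[symmetric] n_apow[OF 1, symmetric] by blast
  then show "N x \<le> n x"
    by (rule le_of_power_le_const[OF vs_normD(1)[OF N] vs_normD(1)[OF n] k])
  obtain M where "\<And>y. y \<in> span {e, x} \<Longrightarrow> n y \<le> M * N y"
    using vs_norm_le_on_span2[OF n N] by blast
  then have "n x ^ (k ^ m) \<le> M * N x ^ (k ^ m)" for m
    using apow_in_span[OF 1[of m], of x] unfolding pow[symmetric] n_apow[OF 1, symmetric] by blast
  then show "n x \<le> N x"
    by (rule le_of_power_le_const[OF vs_normD(1)[OF n] vs_normD(1)[OF N] k])
qed

lemma norm_eq_from_power_identity:
  assumes N: "vs_norm N" and k: "1 < k" and pow: "\<And>x. N (apow x k) = N x ^ k"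
  shows "N = n"
proof (rule ext, rule norm_eq_from_powers[OF N k])
  fix x m
  show "N (apow x (k ^ m)) = N x ^ (k ^ m)"
  proof (induction m)
    case (Suc m)
    have "apow x (k ^ Suc m) = apow (apow x (k ^ m)) k"
      using k by (simp add: apow_mult mult.commute)
    then have "N (apow x (k ^ Suc m)) = (N x ^ (k ^ m)) ^ k" using pow Suc by simp
    also have "\<dots> = N x ^ (k ^ m * k)" by (rule power_mult[symmetric])
    finally show ?case by (simp add: mult.commute)
  qed simp
qed

lemma ex1_natural_norm: "\<exists>!N::'a \<Rightarrow> real. is_natural_norm N"
proof (rule ex1I[where P = is_natural_norm and a = n, OF is_natural_norm])
  fix N :: "'a \<Rightarrow> real" assume "is_natural_norm N"
  then have "vs_norm N" "N (apow x 2) = N x ^ 2" for x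
    unfolding is_natural_norm_def by simp_all
  then show "N = n" by (intro norm_eq_from_power_identity[of N 2]) simp_all
qed

lemma natural_norm_eq: "natural_norm = n"
  unfolding natural_norm_def
  by (rule the1_equality[where P = is_natural_norm, OF ex1_natural_norm is_natural_norm])

end

text \<open>Euler's four-square identity.\<close>

lemma quat_inner_mult: "(x * y) \<bullet> (x * y) = (x \<bullet> x) * (y \<bullet> (y::quat))"
  by (simp add: inner_quat_def quat_ops algebra_simps)

lemma norm_quat_mult: "norm (x * y) = norm x * norm (y::quat)"
  by (simp add: norm_quat_def quat_inner_mult real_sqrt_mult)

lemma RCH_normed_of_isomorphism:
  fixes f :: "'a::real_algebra \<Rightarrow> 'b::{real_algebra_1, real_inner}"
  assumes iso: "isometric_isomorphism N f"
    and mult: "\<And>x y::'b. norm (x * y) = norm x * norm y"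
    and quad: "\<And>y::'b. \<exists>\<alpha> \<beta>. (y - \<alpha> *\<^sub>R 1) * (y - \<alpha> *\<^sub>R 1) = (- (\<beta>\<^sup>2)) *\<^sub>R 1 \<and> (norm y)\<^sup>2 = \<alpha>\<^sup>2 + \<beta>\<^sup>2"
  shows "\<exists>e ip. RCH_normed N e ip"
proof -
  have f: "linear f" "bij f" "\<And>x y. f (x * y) = f x * f y" "\<And>x. norm (f x) = N x"
    using iso by (auto simp: isometric_isomorphism_def)
  note inj = bij_is_inj[OF f(2), THEN inj_eq]
  have f0: "f x = 0 \<longleftrightarrow> x = 0" for x
    using inj[of x 0] by (simp add: linear_0[OF f(1)])
  obtain e where e: "f e = 1" using f(2) by (metis bij_pointE)
  have "RCH_normed N e (\<lambda>x y. f x \<bullet> f y)"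
  proof
    show "e * x = x" "x * e = x" for x
      by (simp_all add: inj[symmetric] f(3) e)
    show "e \<noteq> 0" using e f0[of e] by auto
    show "vs_norm N"
      unfolding vs_norm_def f(4)[symmetric]
      by (simp add: f0 linear_add[OF f(1)] linear_cmul[OF f(1)] norm_triangle_ineq)
    show "inner_product (\<lambda>x y. f x \<bullet> f y)"
      unfolding inner_product_def
      by (auto simp: f0 linear_iff linear_add[OF f(1)] linear_cmul[OF f(1)] inner_add_left intro: inner_commute)
    show "N x = sqrt (f x \<bullet> f x)" for x
      unfolding f(4)[symmetric] by (rule norm_eq_sqrt_inner)
    show "N (x * y) = N x * N y" for x y
      unfolding f(4)[symmetric] f(3) by (rule mult)
    show "\<exists>\<alpha> \<beta>. (x - \<alpha> *\<^sub>R e) * (x - \<alpha> *\<^sub>R e) = (- (\<beta>\<^sup>2)) *\<^sub>R e \<and> (N x)\<^sup>2 = \<alpha>\<^sup>2 + \<beta>\<^sup>2" for x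
      unfolding f(4)[symmetric] inj[symmetric] f(3) linear_diff[OF f(1)] linear_cmul[OF f(1)] e
      by (rule quad)
  qed
  then show ?thesis by blast
qed

lemma RCH_normed_of_isometric:
  assumes "isometric_to_RCH N"
  obtains e ip where "RCH_normed N e ip"
proof -
  have "\<exists>e ip. RCH_normed N e ip"
    using assms unfolding isometric_to_RCH_def
  proof (elim disjE exE)
    fix f :: "'a \<Rightarrow> real" assume "isometric_isomorphism N f"
    then show ?thesis
    proof (rule RCH_normed_of_isomorphism)
      show "\<exists>\<alpha> \<beta>. (y - \<alpha> *\<^sub>R 1) * (y - \<alpha> *\<^sub>R 1) = (- (\<beta>\<^sup>2)) *\<^sub>R 1 \<and> (norm y)\<^sup>2 = \<alpha>\<^sup>2 + \<beta>\<^sup>2" for y :: real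
        by (rule exI[of _ y], rule exI[of _ 0]) simp
    qed (rule norm_mult)
  next
    fix f :: "'a \<Rightarrow> complex" assume "isometric_isomorphism N f"
    then show ?thesis
    proof (rule RCH_normed_of_isomorphism)
      show "\<exists>\<alpha> \<beta>. (y - \<alpha> *\<^sub>R 1) * (y - \<alpha> *\<^sub>R 1) = (- (\<beta>\<^sup>2)) *\<^sub>R 1 \<and> (norm y)\<^sup>2 = \<alpha>\<^sup>2 + \<beta>\<^sup>2" for y :: complex
        by (rule exI[of _ "Re y"], rule exI[of _ "Im y"]) (simp add: complex_eq_iff cmod_power2, simp add: power2_eq_square)
    qed (rule norm_mult)
  next
    fix f :: "'a \<Rightarrow> quat" assume "isometric_isomorphism N f"
    then show ?thesis
    proof (rule RCH_normed_of_isomorphism)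
      fix y :: quat
      define b where "b = (Im4 y)\<^sup>2 + (Jm4 y)\<^sup>2 + (Km4 y)\<^sup>2"
      have "b \<ge> 0" by (simp add: b_def)
      show "\<exists>\<alpha> \<beta>. (y - \<alpha> *\<^sub>R 1) * (y - \<alpha> *\<^sub>R 1) = (- (\<beta>\<^sup>2)) *\<^sub>R 1 \<and> (norm y)\<^sup>2 = \<alpha>\<^sup>2 + \<beta>\<^sup>2"
        by (rule exI[of _ "Re4 y"], rule exI[of _ "sqrt b"])
           (simp add: quat_eq_iff quat_ops power2_norm_eq_inner inner_quat_def \<open>b \<ge> 0\<close>, simp add: b_def power2_eq_square)
    qed (rule norm_quat_mult)
  qed
  then show ?thesis using that by blast
qed

text \<open>An isometry onto a model for any norm is enough, because that norm is a natural one and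
  natural norms are unique. Wherever no particular norm is asked for, it remains to find some such
  N.\<close>

lemma naturally_isometric_to_RCH:
  fixes N :: "'a::real_algebra \<Rightarrow> real"
  assumes "isometric_to_RCH N"
  shows "naturally_isometric_to_RCH TYPE('a)"
proof -
  obtain e ip where "RCH_normed N e ip" using RCH_normed_of_isometric[OF assms] .
  then interpret RCH_normed N e ip .
  show ?thesis
    unfolding naturally_isometric_to_RCH_def natural_norm_eq
    using locally_complex ex1_natural_norm assms by blast
qed

section \<open>Zero-divisors and norms\<close>

lemma Metric_space_vs_norm:
  assumes N: "vs_norm N"
  shows "Metric_space UNIV (\<lambda>x y. N (x - y))"
proof
  show "0 \<le> N (x - y)" for x y by (rule vs_normD(1)[OF N])
  show "N (x - y) = N (y - x)" for x y using vs_normD(6)[OF N, of "x - y"] by simp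
  show "(N (x - y) = 0) = (x = y)" for x y by (simp add: vs_normD(2)[OF N])
  show "N (x - z) \<le> N (x - y) + N (y - z)" for x y z
    using vs_normD(3)[OF N, of "x - y" "y - z"] by simp
qed

lemma continuous_map_norm_topology_iff:
  assumes N: "vs_norm N" and f: "linear f"
  shows "continuous_map (norm_topology N) (norm_topology N) f \<longleftrightarrow> (\<exists>K. \<forall>x. N (f x) \<le> K * N x)"
proof -
  interpret Metric_space UNIV "\<lambda>x y. N (x - y)" by (rule Metric_space_vs_norm[OF N])
  have *: "continuous_map (norm_topology N) (norm_topology N) f \<longleftrightarrow>
      (\<forall>a. \<forall>\<epsilon>>0. \<exists>\<delta>>0. \<forall>x. N (a - x) < \<delta> \<longrightarrow> N (f a - f x) < \<epsilon>)"
    unfolding norm_topology_def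
    by (subst metric_continuous_map[OF Metric_space_vs_norm[OF N]]) simp
  show ?thesis unfolding *
  proof
    assume c: "\<forall>a. \<forall>\<epsilon>>0. \<exists>\<delta>>0. \<forall>x. N (a - x) < \<delta> \<longrightarrow> N (f a - f x) < \<epsilon>"
    from c[rule_format, of 1 0] obtain d where d: "d > 0" "\<And>x. N (0 - x) < d \<Longrightarrow> N (f 0 - f x) < 1"
      by auto
    then have d2: "N x < d \<Longrightarrow> N (f x) < 1" for x
      using vs_normD(6)[OF N] by (simp add: linear_0[OF f])
    have "N (f x) \<le> (2 / d) * N x" for x
    proof (cases "x = 0")
      case False
      then have pos: "N x > 0" using vs_normD(1,2)[OF N, of x] by linarith
      \<comment> \<open>Scales x to length d/2, inside the ball on which N (f x) stays below
        1.\<close>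
      define t where "t = d / (2 * N x)"
      have t: "t > 0" using pos d(1) by (simp add: t_def)
      have "N (t *\<^sub>R x) < d" using pos d(1) by (simp add: t_def vs_normD(4)[OF N])
      then have "N (f (t *\<^sub>R x)) < 1" by (rule d2)
      then have "t * N (f x) < 1" using t by (simp add: linear_cmul[OF f] vs_normD(4)[OF N])
      then show ?thesis using pos d(1) by (simp add: t_def field_simps)
    qed (simp add: linear_0[OF f] vs_normD(5)[OF N])
    then show "\<exists>K. \<forall>x. N (f x) \<le> K * N x" by blast
  next
    assume "\<exists>K. \<forall>x. N (f x) \<le> K * N x"
    then obtain K where K: "\<And>x. N (f x) \<le> K * N x" by blast
    show "\<forall>a. \<forall>\<epsilon>>0. \<exists>\<delta>>0. \<forall>x. N (a - x) < \<delta> \<longrightarrow> N (f a - f x) < \<epsilon>"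
    proof (intro allI impI)
      fix a \<epsilon> :: _ assume "(0::real) < \<epsilon>"
      have "N (f a - f x) < \<epsilon>" if x: "N (a - x) < \<epsilon> / (\<bar>K\<bar> + 1)" for x
      proof -
        have "N (f a - f x) \<le> K * N (a - x)" using K[of "a - x"] by (simp add: linear_diff[OF f])
        also have "\<dots> \<le> (\<bar>K\<bar> + 1) * N (a - x)" by (intro mult_right_mono vs_normD(1)[OF N]) auto
        also have "\<dots> < \<epsilon>" using x by (simp add: field_simps)
        finally show ?thesis .
      qed
      then show "\<exists>\<delta>>0. \<forall>x. N (a - x) < \<delta> \<longrightarrow> N (f a - f x) < \<epsilon>"
        using \<open>0 < \<epsilon>\<close> by (intro exI[of _ "\<epsilon> / (\<bar>K\<bar> + 1)"]) auto
    qed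
  qed
qed

lemma linear_mult_left: "linear (\<lambda>x. a * x)" for a :: "'a::real_algebra"
  by (rule linearI) (simp_all add: distrib_left)

lemma linear_mult_right: "linear (\<lambda>x. x * a)" for a :: "'a::real_algebra"
  by (rule linearI) (simp_all add: distrib_right)

lemma separately_continuous_mult_norm_iff:
  assumes N: "vs_norm N"
  shows "separately_continuous_mult (norm_topology N) \<longleftrightarrow>
    (\<forall>a. (\<exists>K. \<forall>x. N (a * x) \<le> K * N x) \<and> (\<exists>K. \<forall>x. N (x * a) \<le> K * N x))"
  unfolding separately_continuous_mult_def
    continuous_map_norm_topology_iff[OF N linear_mult_left]
    continuous_map_norm_topology_iff[OF N linear_mult_right] ..

lemma separately_continuous_of_submultiplicative:
  assumes N: "vs_norm N" and sub: "submultiplicative N"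
  shows "separately_continuous_mult (norm_topology N)"
  unfolding separately_continuous_mult_norm_iff[OF N]
proof (intro allI conjI)
  fix a
  show "\<exists>K. \<forall>x. N (a * x) \<le> K * N x" using sub unfolding submultiplicative_def by blast
  have "N (x * a) \<le> N a * N x" for x using sub unfolding submultiplicative_def by (metis mult.commute)
  then show "\<exists>K. \<forall>x. N (x * a) \<le> K * N x" by blast
qed

lemma joint_zero_divisor_imp_topological:
  assumes N: "vs_norm N" and "joint_zero_divisor a"
  shows "joint_topological_zero_divisor N a"
proof -
  obtain b where b: "b \<noteq> 0" "a * b = 0" "b * a = 0" using assms(2) by (auto simp: joint_zero_divisor_def)
  have "N b \<noteq> 0" using b(1) vs_normD(2)[OF N] by blast
  then have "N ((1 / N b) *\<^sub>R b) = 1" using vs_normD(1)[OF N, of b] by (simp add: vs_normD(4)[OF N])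
  then show ?thesis
    unfolding joint_topological_zero_divisor_def
    by (intro exI[of _ "\<lambda>n. (1 / N b) *\<^sub>R b"]) (simp add: b vs_normD(5)[OF N])
qed

lemma isometric_to_RCH_no_topological_zero_divisors:
  fixes N :: "'a::real_algebra \<Rightarrow> real"
  assumes nonzero: "\<exists>x::'a. x \<noteq> 0"
    and N: "vs_norm N" and sep: "separately_continuous_mult (norm_topology N)"
    and jtzd: "\<And>a. joint_topological_zero_divisor N a \<Longrightarrow> a = 0"
  shows "\<exists>M::'a \<Rightarrow> real. isometric_to_RCH M"
proof (rule isometric_to_RCH_from_cubic[OF nonzero])
  show "a = 0" if "joint_zero_divisor a" for a :: 'a
    using jtzd joint_zero_divisor_imp_topological[OF N that] by blast
  fix a :: 'a
  show "\<exists>\<alpha> \<beta>. a * (a * a) = (2 * \<alpha>) *\<^sub>R (a * a) - (\<alpha>\<^sup>2 + \<beta>\<^sup>2) *\<^sub>R a"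
  proof (cases "a = 0")
    case False
    define V where "V = {x. a * x = x * a}"
    obtain K where K: "\<And>x. N (a * x) \<le> K * N x"
      using sep unfolding separately_continuous_mult_norm_iff[OF N] by blast
    have "subspace V" by (auto simp: V_def subspace_def algebra_simps)
    moreover have "(*) a ` V \<subseteq> V"
    proof (clarsimp simp: V_def)
      fix x assume "a * x = x * a"
      then show "a * (x * a) = x * a * a" by (metis mult.assoc)
    qed
    moreover have "\<exists>x\<in>V. x \<noteq> 0" using False by (auto simp: V_def)
    ultimately obtain \<alpha> \<beta> where ab: "\<And>\<epsilon>. \<epsilon> > 0 \<Longrightarrow> \<exists>x\<in>V. x \<noteq> 0 \<and>
       N (a * (a * x) - (2 * \<alpha>) *\<^sub>R (a * x) + (\<alpha>\<^sup>2 + \<beta>\<^sup>2) *\<^sub>R x) \<le> \<epsilon> * N x"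
      using approximate_quadratic_eigenvalue[OF N linear_mult_left[of a], of V K] K by blast
    define Q where "Q x = a * (a * x) - (2 * \<alpha>) *\<^sub>R (a * x) + (\<alpha>\<^sup>2 + \<beta>\<^sup>2) *\<^sub>R x" for x
    \<comment> \<open>On the centralizer both products of x with c equal \<open>a * Q x\<close>
      (fact \<open>cx\<close>), and the outer factor a costs only the constant K.\<close>
    define c where "c = a * (a * a) - (2 * \<alpha>) *\<^sub>R (a * a) + (\<alpha>\<^sup>2 + \<beta>\<^sup>2) *\<^sub>R a"
    have "\<forall>n. \<exists>x\<in>V. x \<noteq> 0 \<and> N (Q x) \<le> inverse (real (Suc n)) * N x"
      using ab unfolding Q_def by simp
    then obtain X where X: "\<And>n. X n \<in> V" "\<And>n. X n \<noteq> 0"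
        "\<And>n. N (Q (X n)) \<le> inverse (real (Suc n)) * N (X n)" by metis
    define b where "b n = (1 / N (X n)) *\<^sub>R X n" for n
    have NX: "N (X n) > 0" for n using X(2)[of n] vs_normD(1,2)[OF N, of "X n"] by linarith
    have cx: "c * x = a * Q x" "x * c = a * Q x" if x: "x \<in> V" for x
    proof -
      have xa: "x * a = a * x" using x by (simp add: V_def)
      have xa': "x * (a * y) = a * (x * y)" for y by (metis xa mult.assoc)
      show "c * x = a * Q x" by (simp add: c_def Q_def algebra_simps mult.assoc)
      show "x * c = a * Q x" by (simp add: c_def Q_def algebra_simps mult.assoc xa xa')
    qed
    have lim: "(\<lambda>n. N (a * Q (b n))) \<longlonglongrightarrow> 0"
    proof (rule Lim_null_comparison)
      show "\<forall>\<^sub>F n in sequentially. norm (N (a * Q (b n))) \<le> \<bar>K\<bar> * inverse (real (Suc n))"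
      proof (intro always_eventually allI)
        fix n
        have "Q (b n) = (1 / N (X n)) *\<^sub>R Q (X n)"
          by (simp add: Q_def b_def algebra_simps)
        then have "N (Q (b n)) \<le> inverse (real (Suc n))"
          using X(3)[of n] NX[of n] by (simp add: vs_normD(4)[OF N] field_simps)
        then have "\<bar>K\<bar> * N (Q (b n)) \<le> \<bar>K\<bar> * inverse (real (Suc n))" by (intro mult_left_mono) auto
        moreover have "K * N (Q (b n)) \<le> \<bar>K\<bar> * N (Q (b n))"
          by (intro mult_right_mono vs_normD(1)[OF N]) auto
        ultimately show "norm (N (a * Q (b n))) \<le> \<bar>K\<bar> * inverse (real (Suc n))"
          using K[of "Q (b n)"] vs_normD(1)[OF N, of "a * Q (b n)"] by simp
      qed
      show "(\<lambda>n. \<bar>K\<bar> * inverse (real (Suc n))) \<longlonglongrightarrow> 0"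
        using tendsto_mult_left[OF LIMSEQ_inverse_real_of_nat, of "\<bar>K\<bar>"] by simp
    qed
    have bV: "b n \<in> V" for n using X(1)[of n] by (simp add: b_def V_def)
    have "N (b n) = 1" for n using NX[of n] by (simp add: b_def vs_normD(4)[OF N])
    then have "joint_topological_zero_divisor N c"
      unfolding joint_topological_zero_divisor_def using lim
      by (intro exI[of _ b]) (simp add: cx[OF bV])
    then have "c = 0" by (rule jtzd)
    then have "a * (a * a) = (2 * \<alpha>) *\<^sub>R (a * a) - (\<alpha>\<^sup>2 + \<beta>\<^sup>2) *\<^sub>R a"
      by (simp add: c_def algebra_simps add_eq_0_iff)
    then show ?thesis by blast
  qed simp
qed

section \<open>Quasi-division and supermultiplicativity\<close>

lemma unit_element_unique: "is_unit_element e \<Longrightarrow> is_unit_element e' \<Longrightarrow> e = e'"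
  unfolding is_unit_element_def by metis

text \<open>If ae = a with injective L_a, then a(ex) = ax makes e a left unit. A right defect y = xe
  - x satisfies ye = 0, so y^2 = y(ey) = 0, but nonzero elements have nonzero squares. The case of
  R_a is symmetric, and inverses come from surjectivity and cancellation.\<close>

lemma quasi_division_iff_classical_division:
  assumes nonzero: "\<exists>x::'a::real_algebra. x \<noteq> 0"
  shows "quasi_division TYPE('a) \<longleftrightarrow> classical_division TYPE('a)"
proof
  assume cd: "classical_division TYPE('a)"
  have "bij (\<lambda>x. a * x)" if a: "a \<noteq> 0" for a :: 'a
  proof -
    obtain b where b: "is_unit_element (a * b)" "is_unit_element (b * a)"
      using cd a by (auto simp: classical_division_def invertible_element_def is_inverse_def)
    show ?thesis
      by (rule o_bij[of "\<lambda>x. b * x"]) (use b in \<open>auto simp: fun_eq_iff is_unit_element_def mult.assoc[symmetric]\<close>)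
  qed
  then show "quasi_division TYPE('a)" by (simp add: quasi_division_def)
next
  assume qd: "quasi_division TYPE('a)"
  have qd': "bij (\<lambda>x. a * x) \<or> bij (\<lambda>x. x * a)" if "a \<noteq> 0" for a :: 'a
    using qd that by (simp add: quasi_division_def)
  obtain a :: 'a where a: "a \<noteq> 0" using nonzero by blast
  have sq: "y \<noteq> 0 \<Longrightarrow> y * y \<noteq> 0" for y :: 'a
    using qd'[of y] bij_is_inj[THEN injD, of "\<lambda>x. y * x" y 0] bij_is_inj[THEN injD, of "\<lambda>x. x * y" y 0]
    by auto
  obtain e :: 'a where e: "is_unit_element e"
    using qd'[OF a]
  proof (elim disjE)
    assume bij: "bij (\<lambda>x. a * x)"
    then obtain e where e: "a * e = a" by (metis bij_pointE)
    have l: "e * x = x" for x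
      by (rule bij_is_inj[OF bij, THEN injD]) (simp add: mult.assoc[symmetric] e)
    have "x * e = x" for x
    proof (rule ccontr)
      define y where "y = x * e - x"
      assume "x * e \<noteq> x"
      then have "y \<noteq> 0" by (simp add: y_def)
      moreover have "y * e = 0" by (simp add: y_def left_diff_distrib mult.assoc l)
      then have "y * (e * y) = 0" by (simp add: mult.assoc[symmetric])
      then have "y * y = 0" by (simp add: l)
      ultimately show False using sq by blast
    qed
    with l show ?thesis using that[of e] by (simp add: is_unit_element_def)
  next
    assume bij: "bij (\<lambda>x. x * a)"
    then obtain e where e: "e * a = a" by (metis bij_pointE)
    have r: "x * e = x" for x
      by (rule bij_is_inj[OF bij, THEN injD]) (simp add: mult.assoc e)
    have "e * x = x" for x
    proof (rule ccontr)
      define y where "y = e * x - x"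
      assume "e * x \<noteq> x"
      then have "y \<noteq> 0" by (simp add: y_def)
      moreover have "e * y = 0" by (simp add: y_def right_diff_distrib mult.assoc[symmetric] r)
      then have "(y * e) * y = 0" by (simp add: mult.assoc)
      then have "y * y = 0" by (simp add: r)
      ultimately show False using sq by blast
    qed
    with r show ?thesis using that[of e] by (simp add: is_unit_element_def)
  qed
  have u: "e * x = x" "x * e = x" for x using e by (auto simp: is_unit_element_def)
  have "invertible_element x" if x: "x \<noteq> 0" for x :: 'a
    using qd'[OF x]
  proof (elim disjE)
    assume bij: "bij (\<lambda>y. x * y)"
    then obtain y where y: "x * y = e" by (metis bij_pointE)
    have "y * x = e"
      by (rule bij_is_inj[OF bij, THEN injD]) (simp add: mult.assoc[symmetric] y u)
    then show ?thesis using y e unfolding invertible_element_def is_inverse_def by metis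
  next
    assume bij: "bij (\<lambda>y. y * x)"
    then obtain y where y: "y * x = e" by (metis bij_pointE)
    have "x * y = e"
      by (rule bij_is_inj[OF bij, THEN injD]) (simp add: mult.assoc y u)
    then show ?thesis using y e unfolding invertible_element_def is_inverse_def by metis
  qed
  then show "classical_division TYPE('a)"
    using e by (auto simp: classical_division_def unital_algebra_def)
qed

text \<open>A left inverse b of a would give 1 = N(b a x_n) \<le> K N(a x_n), and the right side
  tends to 0.\<close>

lemma quasi_division_no_topological_zero_divisors:
  fixes N :: "'a::real_algebra \<Rightarrow> real"
  assumes qd: "quasi_division TYPE('a)" and N: "vs_norm N"
    and sep: "separately_continuous_mult (norm_topology N)"
    and jtzd: "joint_topological_zero_divisor N a"
  shows "a = 0"
proof (rule ccontr)
  assume a: "a \<noteq> 0"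
  then have "\<exists>x::'a. x \<noteq> 0" by blast
  then obtain b where b: "is_unit_element (b * a)"
    using qd a unfolding quasi_division_iff_classical_division[OF \<open>\<exists>x::'a. x \<noteq> 0\<close>]
    by (auto simp: classical_division_def invertible_element_def is_inverse_def)
  obtain K where K: "\<And>x. N (b * x) \<le> K * N x"
    using sep unfolding separately_continuous_mult_norm_iff[OF N] by blast
  obtain x where x: "\<And>n. N (x n) = 1" "(\<lambda>n. N (a * x n)) \<longlonglongrightarrow> 0"
    using jtzd by (auto simp: joint_topological_zero_divisor_def)
  have "1 \<le> K * N (a * x n)" for n
    using K[of "a * x n"] b x(1)[of n] by (simp add: is_unit_element_def mult.assoc[symmetric])
  moreover have "(\<lambda>n. K * N (a * x n)) \<longlonglongrightarrow> K * 0"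
    by (intro tendsto_intros x)
  ultimately have "1 \<le> K * 0" by (intro LIMSEQ_le_const) auto
  then show False by simp
qed

lemma supermultiplicative_no_topological_zero_divisors:
  assumes N: "vs_norm N" and c: "c > 0" "supermultiplicative c N"
    and jtzd: "joint_topological_zero_divisor N a"
  shows "a = 0"
proof -
  obtain x where x: "\<And>n. N (x n) = 1" "(\<lambda>n. N (a * x n)) \<longlonglongrightarrow> 0"
    using jtzd by (auto simp: joint_topological_zero_divisor_def)
  have "c * N a \<le> N (a * x n)" for n
    using c(2) x(1)[of n] unfolding supermultiplicative_def by (metis mult.right_neutral)
  then have "c * N a \<le> 0" using x(2) by (intro LIMSEQ_le_const) auto
  then have "N a = 0" using c(1) vs_normD(1)[OF N, of a] by (simp add: mult_le_0_iff)
  then show ?thesis using vs_normD(2)[OF N] by blast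
qed

section \<open>Algebraic algebras\<close>

lemma real_subalgebra_hull: "real_subalgebra (real_subalgebra hull S)"
proof (rule hull_in)
  fix T :: "'a set set" assume "Ball T real_subalgebra"
  then show "real_subalgebra (\<Inter>T)"
    by (auto simp: real_subalgebra_def subspace_def)
qed

lemma isometric_to_RCH_algebraic:
  assumes nonzero: "\<exists>x::'a::real_algebra. x \<noteq> 0"
    and alg: "algebraic_algebra TYPE('a)"
    and jzd: "\<And>a::'a. joint_zero_divisor a \<Longrightarrow> a = 0"
  shows "\<exists>M::'a \<Rightarrow> real. isometric_to_RCH M"
proof (rule isometric_to_RCH_from_cubic[OF nonzero jzd])
  fix a :: 'a
  show "\<exists>\<alpha> \<beta>. a * (a * a) = (2 * \<alpha>) *\<^sub>R (a * a) - (\<alpha>\<^sup>2 + \<beta>\<^sup>2) *\<^sub>R a"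
  proof (cases "a = 0")
    case False
    define V where "V = real_subalgebra hull {a}"
    have V: "subspace V" "\<And>x y. x \<in> V \<Longrightarrow> y \<in> V \<Longrightarrow> x * y \<in> V" "a \<in> V"
      using real_subalgebra_hull[of "{a}"] by (auto simp: V_def real_subalgebra_def hull_inc)
    have comm: "x * a = a * x" if "x \<in> V" for x
    proof -
      have "real_subalgebra {x. x * a = a * x}"
        unfolding real_subalgebra_def subspace_def
        by (simp add: algebra_simps) (metis mult.assoc)
      then have "V \<subseteq> {x. x * a = a * x}"
        unfolding V_def by (intro hull_minimal) auto
      then show ?thesis using that by blast
    qed
    define T where "T = (*) a"
    have T: "linear T" "T ` V \<subseteq> V" using V linear_mult_left by (auto simp: T_def)
    \<comment> \<open>Here p i is the power a^(i+1): without a unit the list of powers starts at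
      a.\<close>
    define p where "p i = (T ^^ i) a" for i
    have pV: "p i \<in> V" for i by (induction i) (use T V in \<open>auto simp: p_def\<close>)
    obtain B where B: "finite B" "span B = V"
      using alg unfolding algebraic_algebra_def fin_dim_def V_def by blast
    define n where "n = card B"
    have "\<exists>c. (\<exists>i\<le>n. c i \<noteq> 0) \<and> (\<Sum>i\<le>n. c i *\<^sub>R p i) = 0"
    \<comment> \<open>\<open>dependent\<close> speaks of the set of powers and does not see
      repetitions; a repeated power gives the relation p i - p j = 0 instead.\<close>
    proof (cases "inj_on p {..n}")
      case True
      have "dependent (p ` {..n})"
      proof (rule ccontr)
        assume "independent (p ` {..n})"
        then have "card (p ` {..n}) \<le> n"
          unfolding n_def by (intro independent_span_bound[THEN conjunct2] B) (use pV B in auto)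
        then show False using True by (simp add: card_image)
      qed
      then obtain u where u: "\<exists>v\<in>p ` {..n}. u v \<noteq> 0" "(\<Sum>v\<in>p ` {..n}. u v *\<^sub>R v) = 0"
        by (auto simp: dependent_finite)
      then show ?thesis
        by (intro exI[of _ "\<lambda>i. u (p i)"]) (auto simp: sum.reindex[OF True])
    next
      case False
      then obtain i j where ij: "i \<le> n" "j \<le> n" "i \<noteq> j" "p i = p j" by (auto simp: inj_on_def)
      define c where "c l = (if l = i then 1 else if l = j then -1 else 0 :: real)" for l
      have "(\<Sum>l\<le>n. c l *\<^sub>R p l) = (\<Sum>l\<in>{i, j}. c l *\<^sub>R p l)"
        using ij by (intro sum.mono_neutral_right) (auto simp: c_def)
      also have "\<dots> = 0" using ij by (simp add: c_def)
      finally show ?thesis using ij(1) by (intro exI[of _ c]) (auto simp: c_def)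
    qed
    then obtain c where c: "\<exists>i\<le>n. c i \<noteq> 0" "(\<Sum>i\<le>n. c i *\<^sub>R p i) = 0" by blast
    define P where "P = (\<Sum>i\<le>n. monom (complex_of_real (c i)) i)"
    have coeff_P: "coeff P i = of_real (c i)" if "i \<le> n" for i
      using that by (simp add: P_def coeff_sum)
    have "P \<noteq> 0" using c(1) coeff_P by (metis coeff_0 of_real_eq_0_iff)
    have deg: "degree P \<le> n"
      unfolding P_def by (intro degree_sum_le) (auto intro: order_trans[OF degree_monom_le])
    have pow: "(map_prod T T ^^ i) (a, 0) = (p i, 0)" for i
      by (induction i) (simp_all add: p_def linear_0[OF T(1)])
    have "cpoly_act T P (a, 0) = (\<Sum>i\<le>n. c i *\<^sub>R (p i, 0))"
      unfolding cpoly_act_altdef[OF deg] by (intro sum.cong) (simp_all add: coeff_P pow)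
    also have "\<dots> = ((\<Sum>i\<le>n. c i *\<^sub>R p i), 0)"
      by (simp add: prod_eq_iff fst_sum snd_sum)
    also have "\<dots> = 0" by (simp add: c(2) zero_prod_def)
    finally have "cpoly_act T P (a, 0) = 0" .
    moreover have "(a, 0) \<in> V \<times> V" "(a, 0 :: 'a) \<noteq> 0"
      using V False by (auto simp: subspace_0 zero_prod_def)
    \<comment> \<open>The eigenvector has its components in the subalgebra generated by a, whose
      elements commute with a, so the zero-divisor obtained from it is two-sided.\<close>
    ultimately obtain l v where v: "v \<in> V \<times> V" "v \<noteq> 0" "cpoly_act T [:- l, 1:] v = 0"
      using cpoly_kernel_linear_factor[OF T(1) V(1) T(2) \<open>P \<noteq> 0\<close>] by blast
    obtain x y where xy: "v = (x, y)" "x \<in> V" "y \<in> V" using v(1) by (cases v) auto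
    define \<alpha> \<beta> where "\<alpha> = Re l" and "\<beta> = Im l"
    define Q where "Q x = a * (a * x) - (2 * \<alpha>) *\<^sub>R (a * x) + (\<alpha>\<^sup>2 + \<beta>\<^sup>2) *\<^sub>R x" for x
    have "(Q x, Q y) = cpoly_act T [:- cnj l, 1:] (cpoly_act T [:- l, 1:] (x, y))"
      unfolding real_quadratic_of_complex_factor[OF T(1)] by (simp add: Q_def T_def \<alpha>_def \<beta>_def)
    also have "\<dots> = 0" using v(3) T(1) by (simp add: xy(1))
    finally have "Q x = 0" "Q y = 0" by (auto simp: zero_prod_def)
    moreover have "x \<noteq> 0 \<or> y \<noteq> 0" using v(2) xy(1) by (auto simp: zero_prod_def)
    ultimately obtain w where w: "w \<in> V" "w \<noteq> 0" "Q w = 0" using xy by blast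
    define d where "d = a * (a * a) - (2 * \<alpha>) *\<^sub>R (a * a) + (\<alpha>\<^sup>2 + \<beta>\<^sup>2) *\<^sub>R a"
    have wa: "w * a = a * w" by (rule comm[OF w(1)])
    have wa': "w * (a * z) = a * (w * z)" for z by (metis wa mult.assoc)
    have "d * w = a * Q w" by (simp add: d_def Q_def algebra_simps mult.assoc)
    moreover have "w * d = a * Q w" by (simp add: d_def Q_def algebra_simps mult.assoc wa wa')
    ultimately have "joint_zero_divisor d" using w by (auto simp: joint_zero_divisor_def)
    then have "d = 0" by (rule jzd)
    then have "a * (a * a) = (2 * \<alpha>) *\<^sub>R (a * a) - (\<alpha>\<^sup>2 + \<beta>\<^sup>2) *\<^sub>R a"
      by (simp add: d_def algebra_simps add_eq_0_iff)
    then show ?thesis by blast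
  qed simp
qed

section \<open>Topological division algebras\<close>

lemma alg_inverse_eq: "is_inverse x y \<Longrightarrow> alg_inverse x = y"
  unfolding alg_inverse_def is_inverse_def is_unit_element_def
  by (rule the_equality) (auto, metis mult.assoc)

lemma continuous_map_scaleR_sum:
  assumes T: "topological_algebra T" and h: "continuous_map X T h" and g: "continuous_map X T g"
    and c: "continuous_map X euclideanreal c"
  shows "continuous_map X T (\<lambda>x. h x + c x *\<^sub>R g x)"
proof -
  have "continuous_map X (prod_topology euclideanreal T) (\<lambda>x. (c x, g x))"
    using c g by (simp add: continuous_map_pairedI)
  moreover have "continuous_map (prod_topology euclideanreal T) T (\<lambda>(r, x). r *\<^sub>R x)"
    using T by (simp add: topological_algebra_def)
  ultimately have "continuous_map X T ((\<lambda>(r, x). r *\<^sub>R x) \<circ> (\<lambda>x. (c x, g x)))"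
    by (rule continuous_map_compose)
  then have "continuous_map X (prod_topology T T) (\<lambda>x. (h x, c x *\<^sub>R g x))"
    using h by (simp add: continuous_map_pairedI o_def)
  moreover have "continuous_map (prod_topology T T) T (\<lambda>(x, y). x + y)"
    using T by (simp add: topological_algebra_def)
  ultimately have "continuous_map X T ((\<lambda>(x, y). x + y) \<circ> (\<lambda>x. (h x, c x *\<^sub>R g x)))"
    by (rule continuous_map_compose)
  then show ?thesis by (simp add: o_def)
qed

text \<open>If no real quadratic polynomial annihilates \<open>a\<close>, then \<open>R l = ((a - Re l)\<^sup>2 + (Im l)\<^sup>2)\<^sup>-\<^sup>1\<close> exists
  for every complex \<open>l\<close>. For \<open>f\<close> in the dual, \<open>f (a R l) - cnj l * f (R l)\<close> is the value of the
  complexified \<open>f\<close> at \<open>(a - l)\<^sup>-\<^sup>1\<close>, an entire function vanishing at infinity.\<close>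

lemma quadratic_of_topological_division:
  fixes T :: "'a::real_algebra topology"
  assumes T: "topological_algebra T" and cd: "classical_division TYPE('a)"
    and dual: "dual_separates_points T" and e: "is_unit_element e" "e \<noteq> 0"
  shows "\<exists>\<alpha> \<beta>. a * a - (2 * \<alpha>) *\<^sub>R a + (\<alpha>\<^sup>2 + \<beta>\<^sup>2) *\<^sub>R e = (0::'a)"
proof (rule ccontr)
  have u: "e * x = x" "x * e = x" for x using e by (auto simp: is_unit_element_def)
  have top: "topspace T = UNIV" and sep: "separately_continuous_mult T"
    and inv_cont: "continuous_map (subtopology T {x. invertible_element x}) T alg_inverse"
    using T by (auto simp: topological_algebra_def)
  have inv: "x * alg_inverse x = e" "alg_inverse x * x = e" "invertible_element x" if x: "x \<noteq> 0" for x :: 'a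
  proof -
    obtain y where y: "is_inverse x y"
      using cd x by (auto simp: classical_division_def invertible_element_def)
    then have xy: "x * y = e" "y * x = e"
      using e(1) unit_element_unique unfolding is_inverse_def by blast+
    then show "x * alg_inverse x = e" "alg_inverse x * x = e" "invertible_element x"
      using alg_inverse_eq[OF y] y by (auto simp: invertible_element_def)
  qed
  have cont_inv: "continuous_map X T (\<lambda>z. alg_inverse (h z))"
    if h: "continuous_map X T h" and nz: "\<And>z. h z \<noteq> 0" for X :: "complex topology" and h
  proof -
    have "continuous_map X (subtopology T {x. invertible_element x}) h"
      using h inv(3)[OF nz] by (auto simp: continuous_map_in_subtopology)
    from continuous_map_compose[OF this inv_cont] show ?thesis by (simp add: o_def)
  qed
  have const: "continuous_map X T (\<lambda>z. c)" for X :: "complex topology" and c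
    by (simp add: top)
  define Q where "Q l = a * a - (2 * Re l) *\<^sub>R a + ((cmod l)\<^sup>2) *\<^sub>R e" for l
  \<comment> \<open>The reversed polynomial: Q' (1/l) = Q l / |l|^2 and Q' 0 = e. It moves the point
    at infinity to 0, where continuity of inversion applies.\<close>
  define Q' where "Q' z = e - (2 * Re z) *\<^sub>R a + ((cmod z)\<^sup>2) *\<^sub>R (a * a)" for z
  assume "\<not> ?thesis"
  then have Qnz: "Q l \<noteq> 0" for l by (auto simp: Q_def cmod_power2)
  have QQ': "Q' (inverse l) = (1 / (cmod l)\<^sup>2) *\<^sub>R Q l" if "l \<noteq> 0" for l
  proof -
    have "Re (inverse l) = Re l / (cmod l)\<^sup>2"
      by (simp only: inverse_complex.simps cmod_power2)
    moreover have "(cmod (inverse l))\<^sup>2 = 1 / (cmod l)\<^sup>2"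
      by (metis inverse_eq_divide norm_inverse power_inverse)
    ultimately show ?thesis
      using that by (simp add: Q_def Q'_def scaleR_right_distrib scaleR_right_diff_distrib)
  qed
  have Q'nz: "Q' z \<noteq> 0" for z
  proof (cases "z = 0")
    case True
    then show ?thesis using e(2) by (simp add: Q'_def)
  next
    case False
    then have "Q' z = (1 / (cmod (inverse z))\<^sup>2) *\<^sub>R Q (inverse z)"
      using QQ'[of "inverse z"] by simp
    then show ?thesis using False Qnz by (simp add: norm_inverse)
  qed
  define R where "R l = alg_inverse (Q l)" for l
  define R' where "R' z = alg_inverse (Q' z)" for z
  have Q_cont: "continuous_map euclidean T Q"
  proof -
    have "continuous_map euclidean T (\<lambda>l. (a * a + (- (2 * Re l)) *\<^sub>R a) + ((cmod l)\<^sup>2) *\<^sub>R e)"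
      by (intro continuous_map_scaleR_sum[OF T] const) (auto intro!: continuous_intros)
    then show ?thesis by (simp add: Q_def[abs_def])
  qed
  have Q'_cont: "continuous_map euclidean T Q'"
  proof -
    have "continuous_map euclidean T (\<lambda>l. (e + (- (2 * Re l)) *\<^sub>R a) + ((cmod l)\<^sup>2) *\<^sub>R (a * a))"
      by (intro continuous_map_scaleR_sum[OF T] const) (auto intro!: continuous_intros)
    then show ?thesis by (simp add: Q'_def[abs_def])
  qed
  have R_cont: "continuous_map euclidean T R" unfolding R_def by (rule cont_inv[OF Q_cont Qnz])
  have R'_cont: "continuous_map euclidean T R'" unfolding R'_def by (rule cont_inv[OF Q'_cont Q'nz])
  have RR': "R l = ((cmod (inverse l))\<^sup>2) *\<^sub>R R' (inverse l)" if l: "l \<noteq> 0" for l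
  proof -
    have "is_inverse (Q l) (((cmod (inverse l))\<^sup>2) *\<^sub>R R' (inverse l))"
    proof -
      have Ql: "Q l = ((cmod l)\<^sup>2) *\<^sub>R Q' (inverse l)" using QQ'[OF l] l by simp
      show ?thesis
        unfolding is_inverse_def Ql R'_def using inv(1,2)[OF Q'nz[of "inverse l"]] e(1) l
        by (simp add: norm_inverse power_inverse)
    qed
    then show ?thesis unfolding R_def by (rule alg_inverse_eq)
  qed
  have QR: "Q l * R l = e" "R l * Q l = e" for l
    unfolding R_def by (rule inv(1)[OF Qnz], rule inv(2)[OF Qnz])
  have aQ: "a * Q l = Q l * a" for l
    by (simp add: Q_def algebra_simps u mult.assoc)
  have aR: "a * R l = R l * a" for l
  proof -
    have "a * R l = R l * Q l * a * R l" by (simp add: QR u)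
    also have "\<dots> = R l * a * (Q l * R l)" by (metis aQ mult.assoc)
    finally show ?thesis by (simp add: QR u)
  qed
  have QRm: "R m * Q l = Q l * R m" for l m
    by (simp add: Q_def algebra_simps u mult.assoc aR) (metis aR mult.assoc)
  have zero: "f (R \<i>) = 0" if f: "f \<in> topological_dual T" for f
  proof -
    have lin: "linear f" and f_cont: "continuous_map T euclideanreal f"
      using f by (auto simp: topological_dual_def)
    note f_simps = linear_add[OF lin] linear_diff[OF lin] linear_cmul[OF lin]
    have cont: "continuous_on UNIV (\<lambda>l. f (c * S l))" if S: "continuous_map euclidean T S" for c S
    proof -
      have "continuous_map T T (\<lambda>x. c * x)" using sep by (simp add: separately_continuous_mult_def)
      from continuous_map_compose[OF continuous_map_compose[OF S this] f_cont]
      show ?thesis by (simp add: o_def)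
    qed
    define g where "g l = complex_of_real (f (a * R l)) - cnj l * complex_of_real (f (R l))" for l
    have deriv: "\<exists>d. (g has_field_derivative d) (at m)" for m
    proof -
      \<comment> \<open>The difference quotient of g, taken from the resolvent identity: h l is the
        complexified f at (a - cnj l)(a - cnj m) R m R l, which is (a - l)^-1 (a - m)^-1.\<close>
      define h where "h l = complex_of_real (f (a * a * R m * R l))
          - (cnj l + cnj m) * complex_of_real (f (a * R m * R l))
          + cnj l * cnj m * complex_of_real (f (R m * R l))" for l
      have quot: "g l - g m = (l - m) * h l" for l
      proof -
        \<comment> \<open>Both resolvents are polynomial multiples of S, namely R l = Q m S and R m
          = Q l S, so the resolvent identity becomes a polynomial identity in the four real numbers
          m0 to m3.\<close>
        define S where "S = R m * R l"
        have Sl: "R l = Q m * S" by (simp add: S_def mult.assoc[symmetric] QR u)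
        have Sm: "R m = Q l * S"
        proof -
          have "R m = R m * (Q l * R l)" by (simp add: QR u)
          also have "\<dots> = Q l * S" by (metis QRm S_def mult.assoc)
          finally show ?thesis .
        qed
        define m0 m1 m2 m3 where "m0 = f S" and "m1 = f (a * S)" and "m2 = f (a * (a * S))"
          and "m3 = f (a * (a * (a * S)))"
        have fR: "f (Q k * S) = m2 - 2 * Re k * m1 + (cmod k)\<^sup>2 * m0"
          "f (a * (Q k * S)) = m3 - 2 * Re k * m2 + (cmod k)\<^sup>2 * m1" for k
          unfolding Q_def m0_def m1_def m2_def m3_def
          by (simp_all add: algebra_simps u mult.assoc f_simps)
        have hl: "h l = complex_of_real m2 - (cnj l + cnj m) * complex_of_real m1 + cnj l * cnj m * complex_of_real m0"
          by (simp add: h_def m0_def m1_def m2_def S_def mult.assoc)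
        have gk: "g l = complex_of_real (m3 - 2 * Re m * m2 + (cmod m)\<^sup>2 * m1)
            - cnj l * complex_of_real (m2 - 2 * Re m * m1 + (cmod m)\<^sup>2 * m0)"
          "g m = complex_of_real (m3 - 2 * Re l * m2 + (cmod l)\<^sup>2 * m1)
            - cnj m * complex_of_real (m2 - 2 * Re l * m1 + (cmod l)\<^sup>2 * m0)"
          unfolding g_def by (simp_all only: Sl Sm fR)
        show ?thesis unfolding hl gk
          by (simp add: complex_eq_iff cmod_power2) (simp add: power2_eq_square algebra_simps)
      qed
      \<comment> \<open>Since m is fixed, l enters each product only through its last factor R l,
        and separate continuity suffices.\<close>
      have "continuous_on UNIV h"
        unfolding h_def by (intro continuous_intros cont R_cont)
      then have "isCont h m" by (simp add: continuous_on_eq_continuous_at)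
      then have "(g has_field_derivative h m) (at m)"
        using quot by (auto simp: CARAT_DERIV mult.commute intro!: exI[of _ h])
      then show ?thesis by blast
    qed
    have "g holomorphic_on UNIV"
      unfolding holomorphic_on_def field_differentiable_def using deriv by simp
    moreover have "(g \<longlongrightarrow> 0) at_infinity"
    proof -
      \<comment> \<open>This is g(1/z) written with R', hence continuous also at z = 0, where its
        value is 0.\<close>
      define k where "k z = complex_of_real ((cmod z)\<^sup>2 * f (a * R' z)) - z * complex_of_real (f (e * R' z))" for z
      have "continuous_on UNIV k"
        unfolding k_def by (intro continuous_intros cont R'_cont)
      then have "isCont k 0" by (simp add: continuous_on_eq_continuous_at)
      then have "(k \<longlongrightarrow> 0) (at 0)" by (simp add: isCont_def k_def)
      then have "((\<lambda>l. k (inverse l)) \<longlongrightarrow> 0) at_infinity"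
        by (rule filterlim_compose) (rule filterlim_inverse_at_iff[THEN iffD2, OF filterlim_ident])
      moreover have "\<forall>\<^sub>F l in at_infinity. k (inverse l) = g l"
      proof -
        have kg: "k (inverse l) = g l" if l: "l \<noteq> 0" for l
        proof -
          have z: "cnj l * complex_of_real ((cmod (inverse l))\<^sup>2) = inverse l"
            unfolding complex_norm_square complex_cnj_inverse using l by simp
          have "g l = complex_of_real ((cmod (inverse l))\<^sup>2 * f (a * R' (inverse l)))
             - (cnj l * complex_of_real ((cmod (inverse l))\<^sup>2)) * complex_of_real (f (R' (inverse l)))"
            unfolding g_def RR'[OF l] by (simp add: f_simps)
          then show ?thesis unfolding z by (simp add: k_def u)
        qed
        show ?thesis
          using eventually_not_equal_at_infinity[of 0] by (rule eventually_mono) (rule kg)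
      qed
      ultimately show ?thesis by (rule Lim_transform_eventually)
    qed
    \<comment> \<open>At the point \<i> the imaginary part of g is f (R \<i>), because cnj \<i> =
      -\<i> and f is real.\<close>
    ultimately have "g \<i> = 0" by (rule Liouville_weak_0)
    then show ?thesis by (simp add: g_def complex_eq_iff)
  qed
  have "R \<i> \<noteq> 0" using QR(1)[of \<i>] e(2) by auto
  then obtain f where f: "f \<in> topological_dual T" "f (R \<i>) \<noteq> f 0"
    using dual by (auto simp: dual_separates_points_def)
  then have "f 0 = 0" by (simp add: topological_dual_def linear_0)
  then show False using f zero by simp
qed

lemma isometric_to_RCH_topological:
  fixes T :: "'a::real_algebra topology"
  assumes nonzero: "\<exists>x::'a. x \<noteq> 0" and T: "topological_algebra T"
    and qd: "quasi_division TYPE('a)" and dual: "dual_separates_points T"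
  shows "\<exists>M::'a \<Rightarrow> real. isometric_to_RCH M"
proof (rule isometric_to_RCH_from_cubic[OF nonzero])
  have cd: "classical_division TYPE('a)"
    using qd quasi_division_iff_classical_division[OF nonzero] by blast
  then obtain e :: 'a where e: "is_unit_element e" by (auto simp: classical_division_def unital_algebra_def)
  then have u: "e * x = x" "x * e = x" for x by (auto simp: is_unit_element_def)
  have "e \<noteq> 0" using nonzero u by (metis mult_zero_left)
  show "a = 0" if "joint_zero_divisor a" for a :: 'a
  proof (rule ccontr)
    assume "a \<noteq> 0"
    then obtain y where y: "is_unit_element (y * a)"
      using cd by (auto simp: classical_division_def invertible_element_def is_inverse_def)
    obtain b where "b \<noteq> 0" "a * b = 0" using \<open>joint_zero_divisor a\<close> by (auto simp: joint_zero_divisor_def)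
    then have "(y * a) * b = 0" by (simp add: mult.assoc)
    then show False using y \<open>b \<noteq> 0\<close> by (simp add: is_unit_element_def)
  qed
  fix a :: 'a
  obtain \<alpha> \<beta> where "a * a - (2 * \<alpha>) *\<^sub>R a + (\<alpha>\<^sup>2 + \<beta>\<^sup>2) *\<^sub>R e = 0"
    using quadratic_of_topological_division[OF T cd dual e \<open>e \<noteq> 0\<close>] by blast
  then have "a * (a * a - (2 * \<alpha>) *\<^sub>R a + (\<alpha>\<^sup>2 + \<beta>\<^sup>2) *\<^sub>R e) = 0" by simp
  then have "a * (a * a) = (2 * \<alpha>) *\<^sub>R (a * a) - (\<alpha>\<^sup>2 + \<beta>\<^sup>2) *\<^sub>R a"
    by (simp add: algebra_simps u add_eq_0_iff)
  then show "\<exists>\<alpha> \<beta>. a * (a * a) = (2 * \<alpha>) *\<^sub>R (a * a) - (\<alpha>\<^sup>2 + \<beta>\<^sup>2) *\<^sub>R a" by blast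
qed

section \<open>Real C*-algebras and power identities\<close>

lemma isometric_to_RCH_power_identity:
  fixes N :: "'a::real_algebra \<Rightarrow> real"
  assumes M: "isometric_to_RCH (M :: 'a \<Rightarrow> real)" and N: "vs_norm N" and k: "1 < k"
    and pow: "\<And>x. N (apow x k) = N x ^ k"
  shows "isometric_to_RCH N \<and> N = natural_norm"
proof -
  obtain e ip where "RCH_normed M e ip" using RCH_normed_of_isometric[OF M] .
  then interpret RCH_normed M e ip .
  have "N = M" by (rule norm_eq_from_power_identity[OF N k pow])
  then show ?thesis using M natural_norm_eq by simp
qed

lemma cstar_scaleR: "cstar (r *\<^sub>R x) = r *\<^sub>R cstar x"
  using cstar_scaleC[of "complex_of_real r" x] by (simp add: scaleC_of_real)

lemma real_cstar_algebra_vs_norm: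
  assumes "real_cstar_algebra TYPE('b::cstar_algebra) N"
  shows "vs_norm N" "submultiplicative N"
proof -
  obtain \<iota> :: "'a \<Rightarrow> 'b" where i: "linear \<iota>" "inj \<iota>" "\<And>x y. \<iota> (x * y) = \<iota> x * \<iota> y" "\<And>x. norm (\<iota> x) = N x"
    using assms by (auto simp: real_cstar_algebra_def)
  have "\<iota> x = 0 \<longleftrightarrow> x = 0" for x using inj_eq[OF i(2), of x 0] by (simp add: linear_0[OF i(1)])
  then show "vs_norm N"
    unfolding vs_norm_def i(4)[symmetric]
    by (simp add: linear_add[OF i(1)] linear_cmul[OF i(1)] norm_triangle_ineq)
  show "submultiplicative N"
    unfolding submultiplicative_def i(4)[symmetric] i(3) by (simp add: norm_mult_ineq)
qed

text \<open>An involution preserves quadratic equations and hence n. For h = s x * x, repeated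
  squaring gives N h = n h; here N h = N(x)^2 by hypothesis and n h = n(s x) n(x) = n(x)^2.\<close>

lemma (in RCH_normed) norm_eq_from_involution:
  fixes N :: "'a \<Rightarrow> real"
  assumes N: "vs_norm N" and s: "linear s" "\<And>x y. s (x * y) = s y * s x" "\<And>x. s (s x) = x"
    and cstar: "\<And>x. N (s x * x) = (N x)\<^sup>2"
  shows "N = n"
proof
  fix x
  have se: "s e = e"
  proof (rule unit_unique, unfold is_unit_element_def, intro allI)
    fix y
    have "s e * y = s (s y * e)" "y * s e = s (e * s y)" by (simp_all only: s(2,3))
    then show "s e * y = y \<and> y * s e = y" by (simp add: unit s(3))
  qed
  have ns: "n (s x) = n x"
  proof -
    obtain \<alpha> where a: "x * x = (2 * \<alpha>) *\<^sub>R x - ((n x)\<^sup>2) *\<^sub>R e" using square_formula by blast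
    obtain \<gamma> where c: "s x * s x = (2 * \<gamma>) *\<^sub>R s x - ((n (s x))\<^sup>2) *\<^sub>R e" using square_formula by blast
    have "s x * s x = s (x * x)" by (simp add: s(2))
    also have "\<dots> = (2 * \<alpha>) *\<^sub>R s x - ((n x)\<^sup>2) *\<^sub>R e"
      unfolding a by (simp add: linear_diff[OF s(1)] linear_cmul[OF s(1)] se)
    finally have eq: "(2 * \<gamma> - 2 * \<alpha>) *\<^sub>R s x = ((n (s x))\<^sup>2 - (n x)\<^sup>2) *\<^sub>R e"
      unfolding c by (simp add: algebra_simps)
    \<comment> \<open>The two quadratic equations of s x have been subtracted. Either the linear
      coefficients agree, and then so do the norms, or s x is a real multiple of e and is fixed by
      s.\<close>
    show ?thesis
    proof (cases "\<gamma> = \<alpha>")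
      case True
      then have "(n (s x))\<^sup>2 = (n x)\<^sup>2" using eq e_nonzero by simp
      then show ?thesis using vs_normD(1)[OF n] by (simp add: power2_eq_iff_nonneg)
    next
      case False
      define m where "m = 2 * \<gamma> - 2 * \<alpha>"
      have "m \<noteq> 0" using False by (simp add: m_def)
      obtain r where r: "m *\<^sub>R s x = r *\<^sub>R e" using eq m_def by blast
      have "(1 / m) *\<^sub>R (m *\<^sub>R s x) = (1 / m) *\<^sub>R (r *\<^sub>R e)" by (simp only: r)
      then have sx: "s x = (r / m) *\<^sub>R e" using \<open>m \<noteq> 0\<close> by simp
      then have "s (s x) = s x" by (simp only: linear_cmul[OF s(1)] se)
      then show ?thesis by (simp add: s(3))
    qed
  qed
  define h where "h = s x * x"
  have h: "s h = h" by (simp add: h_def s(2,3))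
  have pow: "s (apow h (2 ^ m)) = apow h (2 ^ m) \<and> N (apow h (2 ^ m)) = N h ^ (2 ^ m)" for m
  proof (induction m)
    case (Suc m)
    define y where "y = apow h (2 ^ m)"
    have y2: "apow h (2 ^ Suc m) = y * y"
      by (simp add: y_def mult_2 apow_add)
    have "s (y * y) = y * y" using Suc by (simp add: s(2) y_def)
    moreover have "N (y * y) = (N h ^ (2 ^ m))\<^sup>2" using cstar[of y] Suc by (simp add: y_def)
    moreover have "(N h ^ (2 ^ m))\<^sup>2 = N h ^ (2 ^ Suc m)"
      by (simp only: power_mult[symmetric] power_Suc mult.commute)
    ultimately show ?case unfolding y2 by simp
  qed (simp add: h)
  have "N h = n h"
    by (rule norm_eq_from_powers[OF N, of 2]) (simp_all add: pow)
  then have "(N x)\<^sup>2 = (n x)\<^sup>2"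
    using cstar[of x] by (simp add: h_def n_mult ns power2_eq_square)
  then show "N x = n x"
    using vs_normD(1)[OF n] vs_normD(1)[OF N] by (simp add: power2_eq_iff_nonneg)
qed

lemma isometric_to_RCH_cstar:
  fixes N :: "'a::real_algebra \<Rightarrow> real"
  assumes M: "isometric_to_RCH (M :: 'a \<Rightarrow> real)" and N: "real_cstar_algebra TYPE('b::cstar_algebra) N"
  shows "isometric_to_RCH N \<and> N = natural_norm"
proof -
  obtain e ip where "RCH_normed M e ip" using RCH_normed_of_isometric[OF M] .
  then interpret RCH_normed M e ip .
  obtain \<iota> :: "'a \<Rightarrow> 'b" where i: "linear \<iota>" "inj \<iota>" "\<And>x y. \<iota> (x * y) = \<iota> x * \<iota> y"
    "\<And>x. norm (\<iota> x) = N x" "cstar ` range \<iota> \<subseteq> range \<iota>"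
    using N by (auto simp: real_cstar_algebra_def)
  \<comment> \<open>The involution pulled back along \<iota>; \<open>inv \<iota>\<close> is
    meaningful at \<open>cstar (\<iota> x)\<close> because the range of \<iota> is closed under
    \<open>cstar\<close>.\<close>
  define s where "s x = inv \<iota> (cstar (\<iota> x))" for x
  have i_s: "\<iota> (s x) = cstar (\<iota> x)" for x
    unfolding s_def using i(5) by (intro f_inv_into_f) auto
  note inj = inj_eq[OF i(2), symmetric]
  have "N = M"
  proof (rule norm_eq_from_involution)
    show "vs_norm N" by (rule real_cstar_algebra_vs_norm[OF N])
    show "linear s"
      by (rule linearI)
        (simp_all add: inj i_s linear_add[OF i(1)] linear_cmul[OF i(1)] cstar_add cstar_scaleR)
    show "s (x * y) = s y * s x" for x y by (simp add: inj i_s i(3) cstar_mult)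
    show "s (s x) = x" for x by (simp add: inj i_s cstar_cstar)
    show "N (s x * x) = (N x)\<^sup>2" for x
      unfolding i(4)[symmetric] i(3) i_s by (rule norm_cstar_mult)
  qed
  then show ?thesis using M natural_norm_eq by simp
qed

lemma absolute_value_properties:
  assumes "absolute_value N"
  shows "vs_norm N" "submultiplicative N" "supermultiplicative 1 N" "N (apow x 2) = N x ^ 2"
  using assms by (auto simp: absolute_value_def submultiplicative_def supermultiplicative_def
      apow_2 power2_eq_square)

theorem theorem5p7:
  assumes nonzero: "\<exists>x::'a::real_algebra. x \<noteq> 0"
  shows
    "(algebraic_algebra TYPE('a) \<and> (\<forall>a::'a. joint_zero_divisor a \<longrightarrow> a = 0)
        \<longrightarrow> naturally_isometric_to_RCH TYPE('a))
   \<and>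
     ((\<exists>N::'a \<Rightarrow> real. vs_norm N \<and> separately_continuous_mult (norm_topology N) \<and>
          (\<forall>a. joint_topological_zero_divisor N a \<longrightarrow> a = 0)) \<or>
      (quasi_division TYPE('a) \<and>
        (\<exists>N::'a \<Rightarrow> real. vs_norm N \<and> separately_continuous_mult (norm_topology N))) \<or>
      (\<exists>(N::'a \<Rightarrow> real) c. vs_norm N \<and> c > 0 \<and> supermultiplicative c N \<and>
          separately_continuous_mult (norm_topology N)) \<or>
      (\<exists>T::'a topology. topological_algebra T \<and> quasi_division TYPE('a) \<and>
          dual_separates_points T)
        \<longrightarrow> naturally_isometric_to_RCH TYPE('a))
   \<and>
     (\<forall>N::'a \<Rightarrow> real. nearly_absolute_value N \<longrightarrow>
        vs_norm N \<and> (\<exists>c>0. supermultiplicative c N) \<and>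
        separately_continuous_mult (norm_topology N))
   \<and>
     (\<forall>T::'a topology. topological_algebra T \<longrightarrow>
        (quasi_division TYPE('a) \<longleftrightarrow> classical_division TYPE('a)))
   \<and>
     (\<forall>N::'a \<Rightarrow> real.
        (real_cstar_algebra TYPE('b::cstar_algebra) N \<and>
          ((\<forall>a. joint_topological_zero_divisor N a \<longrightarrow> a = 0) \<or> quasi_division TYPE('a))) \<or>
        (quasi_division TYPE('a) \<and> vs_norm N \<and> separately_continuous_mult (norm_topology N) \<and>
          (\<exists>k>1. \<forall>x. N (apow x k) = N x ^ k)) \<or>
        (vs_norm N \<and> separately_continuous_mult (norm_topology N) \<and>
          (\<exists>k>1. \<forall>x. N (apow x k) = N x ^ k) \<and>
          (\<forall>a. joint_topological_zero_divisor N a \<longrightarrow> a = 0)) \<or>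
        absolute_value N
        \<longrightarrow> isometric_to_RCH N \<and> naturally_isometric_to_RCH TYPE('a) \<and> N = natural_norm)"
proof -
  \<comment> \<open>The conditions first yield only some norm M isometric to a model. That a given N
    equals M is a separate step, through a power identity or an involution.\<close>
  have no_jtzd: "\<exists>M::'a \<Rightarrow> real. isometric_to_RCH M"
    if "vs_norm N" "separately_continuous_mult (norm_topology N)"
      "(\<forall>a. joint_topological_zero_divisor N a \<longrightarrow> a = 0) \<or> quasi_division TYPE('a)" for N :: "'a \<Rightarrow> real"
  proof (rule isometric_to_RCH_no_topological_zero_divisors[OF nonzero that(1,2)])
    show "a = 0" if "joint_topological_zero_divisor N a" for a
      using \<open>_ \<or> quasi_division TYPE('a)\<close> that
        quasi_division_no_topological_zero_divisors[OF _ \<open>vs_norm N\<close> \<open>separately_continuous_mult _\<close>] by blast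
  qed
  have super: "\<exists>M::'a \<Rightarrow> real. isometric_to_RCH M"
    if "vs_norm N" "separately_continuous_mult (norm_topology N)" "c > 0" "supermultiplicative c N"
    for N :: "'a \<Rightarrow> real" and c
    using no_jtzd[OF that(1,2)] supermultiplicative_no_topological_zero_divisors[OF that(1,3,4)] by blast
  have power: "isometric_to_RCH N \<and> N = natural_norm"
    if H: "vs_norm N" "separately_continuous_mult (norm_topology N)"
      "(\<forall>a. joint_topological_zero_divisor N a \<longrightarrow> a = 0) \<or> quasi_division TYPE('a)"
      "1 < k" "\<And>x. N (apow x k) = N x ^ k" for N :: "'a \<Rightarrow> real" and k
  proof -
    obtain M :: "'a \<Rightarrow> real" where "isometric_to_RCH M" using no_jtzd[OF H(1-3)] ..
    then show ?thesis using H(1,4,5) by (rule isometric_to_RCH_power_identity)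
  qed
  show ?thesis
  proof (intro conjI allI; (intro impI)?)
    assume "algebraic_algebra TYPE('a) \<and> (\<forall>a::'a. joint_zero_divisor a \<longrightarrow> a = 0)"
    then show "naturally_isometric_to_RCH TYPE('a)"
      using isometric_to_RCH_algebraic[OF nonzero] naturally_isometric_to_RCH by blast
  next
    assume "(\<exists>N::'a \<Rightarrow> real. vs_norm N \<and> separately_continuous_mult (norm_topology N) \<and>
          (\<forall>a. joint_topological_zero_divisor N a \<longrightarrow> a = 0)) \<or>
      (quasi_division TYPE('a) \<and>
        (\<exists>N::'a \<Rightarrow> real. vs_norm N \<and> separately_continuous_mult (norm_topology N))) \<or>
      (\<exists>(N::'a \<Rightarrow> real) c. vs_norm N \<and> c > 0 \<and> supermultiplicative c N \<and>
          separately_continuous_mult (norm_topology N)) \<or>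
      (\<exists>T::'a topology. topological_algebra T \<and> quasi_division TYPE('a) \<and>
          dual_separates_points T)"
    then have "\<exists>M::'a \<Rightarrow> real. isometric_to_RCH M"
    proof (elim disjE exE conjE)
      fix N :: "'a \<Rightarrow> real"
      assume "vs_norm N" "separately_continuous_mult (norm_topology N)"
        "\<forall>a. joint_topological_zero_divisor N a \<longrightarrow> a = 0"
      then show ?thesis by (intro no_jtzd[of N] disjI1)
    next
      fix N :: "'a \<Rightarrow> real"
      assume "vs_norm N" "separately_continuous_mult (norm_topology N)" "quasi_division TYPE('a)"
      then show ?thesis by (intro no_jtzd[of N] disjI2)
    next
      fix N :: "'a \<Rightarrow> real" and c :: real
      assume "vs_norm N" "separately_continuous_mult (norm_topology N)" "c > 0" "supermultiplicative c N"
      then show ?thesis by (rule super)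
    next
      fix T :: "'a topology"
      assume "topological_algebra T" "quasi_division TYPE('a)" "dual_separates_points T"
      then show ?thesis by (rule isometric_to_RCH_topological[OF nonzero])
    qed
    then show "naturally_isometric_to_RCH TYPE('a)"
      using naturally_isometric_to_RCH by blast
  next
    fix N :: "'a \<Rightarrow> real" assume "nearly_absolute_value N"
    then have N: "vs_norm N" "submultiplicative N" "\<exists>c>0. supermultiplicative c N"
      by (auto simp: nearly_absolute_value_def)
    then show "vs_norm N \<and> (\<exists>c>0. supermultiplicative c N) \<and>
        separately_continuous_mult (norm_topology N)"
      using separately_continuous_of_submultiplicative by blast
  next
    fix T :: "'a topology"
    show "quasi_division TYPE('a) \<longleftrightarrow> classical_division TYPE('a)"
      by (rule quasi_division_iff_classical_division[OF nonzero])
  next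
    fix N :: "'a \<Rightarrow> real"
    assume "(real_cstar_algebra TYPE('b) N \<and>
          ((\<forall>a. joint_topological_zero_divisor N a \<longrightarrow> a = 0) \<or> quasi_division TYPE('a))) \<or>
        (quasi_division TYPE('a) \<and> vs_norm N \<and> separately_continuous_mult (norm_topology N) \<and>
          (\<exists>k>1. \<forall>x. N (apow x k) = N x ^ k)) \<or>
        (vs_norm N \<and> separately_continuous_mult (norm_topology N) \<and>
          (\<exists>k>1. \<forall>x. N (apow x k) = N x ^ k) \<and>
          (\<forall>a. joint_topological_zero_divisor N a \<longrightarrow> a = 0)) \<or>
        absolute_value N"
    then have "isometric_to_RCH N \<and> N = natural_norm"
    proof (elim disjE)
      assume A: "real_cstar_algebra TYPE('b) N \<and>
          ((\<forall>a. joint_topological_zero_divisor N a \<longrightarrow> a = 0) \<or> quasi_division TYPE('a))"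
      note N = real_cstar_algebra_vs_norm[OF conjunct1[OF A]]
      obtain M :: "'a \<Rightarrow> real" where "isometric_to_RCH M"
        using no_jtzd[OF N(1) separately_continuous_of_submultiplicative[OF N] conjunct2[OF A]] ..
      then show ?thesis using conjunct1[OF A] by (rule isometric_to_RCH_cstar)
    next
      assume A: "quasi_division TYPE('a) \<and> vs_norm N \<and> separately_continuous_mult (norm_topology N) \<and>
          (\<exists>k>1. \<forall>x. N (apow x k) = N x ^ k)"
      then obtain k where k: "1 < k" "\<And>x. N (apow x k) = N x ^ k" by blast
      show ?thesis by (rule power[of N k, OF _ _ _ k]) (use A in simp_all)
    next
      assume A: "vs_norm N \<and> separately_continuous_mult (norm_topology N) \<and>
          (\<exists>k>1. \<forall>x. N (apow x k) = N x ^ k) \<and>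
          (\<forall>a. joint_topological_zero_divisor N a \<longrightarrow> a = 0)"
      then obtain k where k: "1 < k" "\<And>x. N (apow x k) = N x ^ k" by blast
      show ?thesis by (rule power[of N k, OF _ _ _ k]) (use A in simp_all)
    next
      assume "absolute_value N"
      \<comment> \<open>An absolute value is supermultiplicative with c = 1 and satisfies the power
        identity with k = 2.\<close>
      note N = absolute_value_properties[OF this]
      obtain M :: "'a \<Rightarrow> real" where "isometric_to_RCH M"
        using super[OF N(1) separately_continuous_of_submultiplicative[OF N(1,2)] zero_less_one N(3)] ..
      then show ?thesis by (rule isometric_to_RCH_power_identity[where k = 2, OF _ N(1) _ N(4)]) simp
    qed
    then show "isometric_to_RCH N \<and> naturally_isometric_to_RCH TYPE('a) \<and> N = natural_norm"
      using naturally_isometric_to_RCH by blast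
  qed
qed

end
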